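(* For every $\varepsilon>0$ there exists a sequence of unsatisfiable hitting formulas $G_m$, each containing $2^{\tilde O(m)}$ clauses, each clause of width at most $\tilde O(m)$, such that every tree-like resolution refutation of $G_m$ has size $2^{\tilde\Omega(m^{2-\varepsilon})}$.
   Context: A hitting formula is a CNF in which every two distinct clauses contain complementary literals (some literal $\ell$ in one and $\bar\ell$ in the other). The width of a clause is its number of literals. Tree-like resolution refutations are resolution refutations in which every derived clause is used at most once as a premise; size is the number of clauses. $\tilde O(f)$ denotes $O(f\log^C f)$ and $\tilde\Omega(f)$ denotes $\Omega(f/\log^C f)$ for some constant $C$. *)

theory Defs
  imports Complex_Main "HOL-Library.Landau_Symbols"
begin

datatype 'v literal = Pos 'v | Neg 'v

fun compl_lit :: "'v literal \<Rightarrow> 'v literal" where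
  "compl_lit (Pos x) = Neg x"
| "compl_lit (Neg x) = Pos x"

fun lit_true :: "('v \<Rightarrow> bool) \<Rightarrow> 'v literal \<Rightarrow> bool" where
  "lit_true \<alpha> (Pos x) = \<alpha> x"
| "lit_true \<alpha> (Neg x) = (\<not> \<alpha> x)"

type_synonym 'v clause = "'v literal set"
type_synonym 'v cnf = "'v clause set"

definition width :: "'v clause \<Rightarrow> nat" where
  "width C = card C"

definition tautological :: "'v clause \<Rightarrow> bool" where
  "tautological C \<longleftrightarrow> (\<exists>l\<in>C. compl_lit l \<in> C)"

text \<open>Formulas consist of finitely many finite clauses. As usual, no clause of a formula contains
  a complementary pair; clauses derived in a resolution proof are not restricted in this way.\<close>

definition is_cnf :: "'v cnf \<Rightarrow> bool" where
  "is_cnf F \<longleftrightarrow> finite F \<and> (\<forall>C\<in>F. finite C \<and> \<not> tautological C)"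

definition unsatisfiable :: "'v cnf \<Rightarrow> bool" where
  "unsatisfiable F \<longleftrightarrow> \<not> (\<exists>\<alpha>. \<forall>C\<in>F. \<exists>l\<in>C. lit_true \<alpha> l)"

definition hitting_formula :: "'v cnf \<Rightarrow> bool" where
  "hitting_formula F \<longleftrightarrow>
     is_cnf F \<and> (\<forall>C\<in>F. \<forall>D\<in>F. C \<noteq> D \<longrightarrow> (\<exists>l\<in>C. compl_lit l \<in> D))"

definition resolvent :: "'v clause \<Rightarrow> 'v clause \<Rightarrow> 'v clause \<Rightarrow> bool" where
  "resolvent C D E \<longleftrightarrow>
     (\<exists>l. l \<in> C \<and> compl_lit l \<in> D \<and> E = (C - {l}) \<union> (D - {compl_lit l}))"

text \<open>A resolution proof is a sequence of clauses. Each line records its justification: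
  \<open>Initial C\<close> is a clause of the formula, \<open>Derived C i j\<close> is a resolvent of lines \<open>i\<close> and \<open>j\<close>
  (counted from 0). The same clause may occur on several lines.\<close>

datatype 'v line =
    Initial (line_clause: "'v clause")
  | is_Derived: Derived (line_clause: "'v clause") nat nat

fun line_premises :: "'v line \<Rightarrow> nat list" where
  "line_premises (Initial C) = []"
| "line_premises (Derived C i j) = [i, j]"

fun valid_line :: "'v cnf \<Rightarrow> 'v line list \<Rightarrow> nat \<Rightarrow> 'v line \<Rightarrow> bool" where
  "valid_line F \<pi> k (Initial C) = (C \<in> F)"
| "valid_line F \<pi> k (Derived C i j) =
     (i < k \<and> j < k \<and> resolvent (line_clause (\<pi> ! i)) (line_clause (\<pi> ! j)) C)"

definition resolution_refutation :: "'v cnf \<Rightarrow> 'v line list \<Rightarrow> bool" where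
  "resolution_refutation F \<pi> \<longleftrightarrow>
     (\<forall>k<length \<pi>. valid_line F \<pi> k (\<pi> ! k)) \<and> \<pi> \<noteq> [] \<and> line_clause (last \<pi>) = {}"

text \<open>Only derived lines are restricted to a single use: clauses of the formula may be used
  arbitrarily often.\<close>

definition tree_like :: "'v line list \<Rightarrow> bool" where
  "tree_like \<pi> \<longleftrightarrow>
     (\<forall>k<length \<pi>. is_Derived (\<pi> ! k) \<longrightarrow>
        count_list (concat (map line_premises \<pi>)) k \<le> 1)"

definition refutation_size :: "'v line list \<Rightarrow> nat" where
  "refutation_size \<pi> = length \<pi>"

definition soft_O :: "(nat \<Rightarrow> real) \<Rightarrow> (nat \<Rightarrow> real) set" where
  "soft_O f = {g. \<exists>C::nat. g \<in> O(\<lambda>m. f m * ln (f m) ^ C)}"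

text \<open>The library's \<open>\<Omega>\<close> bounds absolute values only. Nonnegativity is required here so that
  membership is a genuine lower bound on \<open>g\<close> itself.\<close>

definition soft_Omega :: "(nat \<Rightarrow> real) \<Rightarrow> (nat \<Rightarrow> real) set" where
  "soft_Omega f = {g. (\<forall>m. 0 \<le> g m) \<and> (\<exists>C::nat. g \<in> \<Omega>(\<lambda>m. f m / ln (f m) ^ C))}"

end

theory Submission
  imports Defs "HOL-Library.Nat_Bijection" "HOL-Library.Countable"
begin

text \<open>
  A selector of a Boolean function \<open>f\<close> assigns to every input a set of variables to read, such that
  inputs agreeing on that set get the same set and the same value. It partitions the cube into
  subcubes, and the clauses falsified exactly on these subcubes form an unsatisfiable hitting formula.
  So one needs functions with selectors of size about \<open>m\<close> and query complexity about \<open>m\<^sup>2\<close>.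

  They are built by iterating the cheat sheet construction with or-and composition, following
  Ambainis, Kokainis and Kothari. If \<open>f\<close> has ordinary certificates of size \<open>n\<^sup>j\<close>, a selector of
  size \<open>n\<^sup>j\<^sup>+\<^sup>1\<close> and query complexity \<open>n\<^sup>2\<^sup>j\<close>, then its cheat sheet version has a selector that
  reads only about \<open>n\<^sup>j\<close> variables when the value is true. Or-and composition of width \<open>n\<close> then
  raises the three measures to \<open>n\<^sup>j\<^sup>+\<^sup>1\<close>, \<open>n\<^sup>j\<^sup>+\<^sup>2\<close> and \<open>n\<^sup>2\<^sup>j\<^sup>+\<^sup>2\<close>, up to powers of \<open>log n\<close>. Replacing
  every variable by the exclusive or of two turns query complexity \<open>d\<close> into tree-like size \<open>2\<^sup>d\<close>.
\<close>

section \<open>The query game\<close>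

text \<open>\<open>hard A d g\<close> says that an adversary can answer fewer than \<open>d\<close> queries so that every value in
  \<open>A\<close> stays possible for \<open>g\<close>. An answer is recorded by precomposing \<open>g\<close> with an update, which makes
  answers to repeated queries consistent.\<close>

primrec hard :: "'b set \<Rightarrow> nat \<Rightarrow> ((nat \<Rightarrow> bool) \<Rightarrow> 'b) \<Rightarrow> bool" where
  "hard A 0 g = True"
| "hard A (Suc d) g = (A \<subseteq> range g \<and> (\<forall>x. \<exists>b. hard A d (\<lambda>\<alpha>. g (\<alpha>(x := b)))))"

lemma hard_SucD: "hard A (Suc d) g \<Longrightarrow> hard A d g"
proof (induction d arbitrary: g)
  case (Suc d)
  then show ?case by (metis hard.simps(2))
qed simp

lemma hard_Suc_attains:
  assumes "hard A (Suc d) g" "y \<in> A"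
  shows "\<exists>\<alpha>. g \<alpha> = y"
proof -
  have "y \<in> range g"
    using assms by auto
  then show ?thesis
    by auto
qed

lemma hard_UNIV_not: "hard UNIV d f \<Longrightarrow> hard UNIV d (\<lambda>\<alpha>. \<not> f \<alpha>)"
proof (induction d arbitrary: f)
  case (Suc d)
  have "b \<in> range (\<lambda>\<alpha>. \<not> f \<alpha>)" for b
  proof -
    obtain \<alpha> where "f \<alpha> = (\<not> b)"
      using hard_Suc_attains[OF Suc.prems] by blast
    then show ?thesis
      by (intro image_eqI[of _ _ \<alpha>]) auto
  qed
  moreover have "\<exists>b. hard UNIV d (\<lambda>\<alpha>. \<not> f (\<alpha>(x := b)))" for x
  proof -
    obtain b where "hard UNIV d (\<lambda>\<alpha>. f (\<alpha>(x := b)))"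
      using Suc.prems by auto
    from Suc.IH[OF this] show ?thesis ..
  qed
  ultimately show ?case
    by auto
qed simp

section \<open>Splitting an input into blocks\<close>

text \<open>All inputs are indexed by \<open>nat\<close>; \<open>prod_encode\<close> supplies
  infinitely many disjoint copies of the index set, so composed functions take inputs of the same
  type as their parts.\<close>

definition block :: "nat \<Rightarrow> (nat \<Rightarrow> bool) \<Rightarrow> nat \<Rightarrow> bool" where
  "block i \<alpha> = (\<lambda>x. \<alpha> (prod_encode (i, x)))"

definition join :: "(nat \<Rightarrow> nat \<Rightarrow> bool) \<Rightarrow> nat \<Rightarrow> bool" where
  "join \<beta> = (\<lambda>v. case prod_decode v of (i, x) \<Rightarrow> \<beta> i x)"

lemma block_join [simp]: "block i (join \<beta>) = \<beta> i"
  by (simp add: block_def join_def)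

lemma block_upd:
  "block i (\<alpha>(prod_encode (j, x) := b)) = (if i = j then (block i \<alpha>)(x := b) else block i \<alpha>)"
  by (auto simp: block_def)

text \<open>The adversary answers inside block \<open>i\<close> by its strategy for \<open>f i\<close>. If the next answer
  has to fix the value of \<open>f i\<close>, then it is fixed to true, and the block is discarded.\<close>

lemma hard_All:
  assumes "finite I" "I \<noteq> {}" "\<And>i. i \<in> I \<Longrightarrow> hard UNIV (e i) (f i) \<and> 0 < e i"
    and "d \<le> sum e I"
  shows "hard UNIV d (\<lambda>\<alpha>. \<forall>i\<in>I. f i (block i \<alpha>))"
  using assms
proof (induction d arbitrary: I e f)
  case (Suc d)
  note prems = Suc.prems
  have "\<exists>\<alpha>. f i \<alpha> = b" if "i \<in> I" for i b
  proof -
    obtain k where "e i = Suc k"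
      using prems(3)[OF \<open>i \<in> I\<close>] by (cases "e i") auto
    then have "hard UNIV (Suc k) (f i)"
      using prems(3)[OF \<open>i \<in> I\<close>] by simp
    then show ?thesis
      by (rule hard_Suc_attains) simp
  qed
  then obtain a where a: "\<And>i b. i \<in> I \<Longrightarrow> f i (a i b) = b"
    by metis
  have "b \<in> range (\<lambda>\<alpha>. \<forall>i\<in>I. f i (block i \<alpha>))" for b
  proof
    show "b = (\<forall>i\<in>I. f i (block i (join (\<lambda>i. a i b))))"
      using a prems(2) by auto
  qed simp
  moreover have "\<exists>b. hard UNIV d (\<lambda>\<alpha>. \<forall>i\<in>I. f i (block i (\<alpha>(v := b))))" for v
  proof -
    obtain j x where v: "v = prod_encode (j, x)"
      by (metis prod_decode_inverse surj_pair)
    \<comment> \<open>The answer is absorbed into the function of block \<open>j\<close>; this is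
      why the statement is about a family \<open>f\<close> rather than copies of one
      function.\<close>
    define f' where "f' b = f(j := (\<lambda>\<beta>. f j (\<beta>(x := b))))" for b
    have f': "(\<lambda>\<alpha>. \<forall>i\<in>I. f i (block i (\<alpha>(v := b)))) = (\<lambda>\<alpha>. \<forall>i\<in>I. f' b i (block i \<alpha>))" for b
      by (auto simp: f'_def v block_upd fun_eq_iff)
    consider "j \<notin> I" | "j \<in> I" "2 \<le> e j" | "j \<in> I" "e j = 1"
      using prems(3)[of j] by fastforce
    then show ?thesis
    proof cases
      case 1
      then show ?thesis
        unfolding f' using prems by (intro exI Suc.IH[of I e]) (auto simp: f'_def)
    next
      case 2
      then obtain k where k: "e j = Suc k" "0 < k"
        by (cases "e j") auto
      then obtain b where "hard UNIV k (\<lambda>\<beta>. f j (\<beta>(x := b)))"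
        using prems(3)[OF 2(1)] by auto
      then have "hard UNIV d (\<lambda>\<alpha>. \<forall>i\<in>I. f' b i (block i \<alpha>))"
        using prems k 2 by (intro Suc.IH[of I "e(j := k)"])
          (auto simp: f'_def sum.remove[of I j] cong: sum.cong_simp)
      then show ?thesis
        unfolding f' by blast
    next
      case 3
      show ?thesis
      proof (cases "\<exists>b. hard UNIV 1 (\<lambda>\<beta>. f j (\<beta>(x := b)))")
        case True
        then obtain b where "hard UNIV 1 (\<lambda>\<beta>. f j (\<beta>(x := b)))" ..
        then have "hard UNIV d (\<lambda>\<alpha>. \<forall>i\<in>I. f' b i (block i \<alpha>))"
          using prems 3 by (intro Suc.IH[of I e]) (auto simp: f'_def)
        then show ?thesis
          unfolding f' by blast
      next
        case False
        \<comment> \<open>The bit is copied from an input on which \<open>f j\<close> is true, so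
          true stays possible. Since no answer keeps both values possible, \<open>f j\<close> is
          then constantly true.\<close>
        define b where "b = a j True x"
        have "f j ((a j True)(x := b))"
          using a[of j True] 3 by (simp add: b_def)
        then have const: "f j (\<beta>(x := b))" for \<beta>
        proof -
          have "range (\<lambda>\<beta>. f j (\<beta>(x := b))) \<noteq> UNIV"
            using False by auto
          then have "False \<notin> range (\<lambda>\<beta>. f j (\<beta>(x := b)))"
            using \<open>f j ((a j True)(x := b))\<close> by (auto simp: UNIV_bool image_iff)
          then show ?thesis
            by (auto simp: image_iff)
        qed
        have "(\<lambda>\<alpha>. \<forall>i\<in>I. f' b i (block i \<alpha>)) = (\<lambda>\<alpha>. \<forall>i\<in>I - {j}. f i (block i \<alpha>))"
          using const by (auto simp: f'_def fun_eq_iff)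
        moreover have "hard UNIV d (\<lambda>\<alpha>. \<forall>i\<in>I - {j}. f i (block i \<alpha>))"
        \<comment> \<open>Dropping block \<open>j\<close> may leave no block at all, but then the
          whole budget was 1 and \<open>d\<close> is 0.\<close>
        proof (cases "I = {j}")
          case True
          then have "d = 0"
            using prems 3 by simp
          then show ?thesis
            by simp
        next
          case False
          then show ?thesis
            using prems 3 by (intro Suc.IH[of _ e]) (auto simp: sum.remove[of I j])
        qed
        ultimately show ?thesis
          unfolding f' by (intro exI[of _ b]) simp
      qed
    qed
  qed
  ultimately show ?case
    by auto
qed simp

text \<open>De Morgan turns the disjunction into a conjunction of negations, and
  \<open>hard UNIV\<close> is invariant under negation.\<close>

lemma hard_Ex:
  assumes "finite I" "I \<noteq> {}" "\<And>i. i \<in> I \<Longrightarrow> hard UNIV (e i) (f i) \<and> 0 < e i"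
    and "d \<le> sum e I"
  shows "hard UNIV d (\<lambda>\<alpha>. \<exists>i\<in>I. f i (block i \<alpha>))"
proof -
  have "hard UNIV d (\<lambda>\<alpha>. \<forall>i\<in>I. \<not> f i (block i \<alpha>))"
    using assms hard_UNIV_not by (intro hard_All[where e = e and f = "\<lambda>i \<alpha>. \<not> f i \<alpha>"]) auto
  from hard_UNIV_not[OF this] show ?thesis
    by simp
qed

definition or_and :: "nat \<Rightarrow> ((nat \<Rightarrow> bool) \<Rightarrow> bool) \<Rightarrow> (nat \<Rightarrow> bool) \<Rightarrow> bool" where
  "or_and n f \<alpha> = (\<exists>i\<in>{..<n}. \<forall>j\<in>{..<n}. f (block j (block i \<alpha>)))"

text \<open>Budgets add up over the \<open>n\<close> conjuncts of each disjunct and again over the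
  \<open>n\<close> disjuncts.\<close>

lemma hard_or_and:
  assumes "hard UNIV d f" "0 < d" "0 < n"
  shows "hard UNIV (n\<^sup>2 * d) (or_and n f)"
  unfolding or_and_def
proof (rule hard_Ex[where e = "\<lambda>_. n * d" and f = "\<lambda>_ \<beta>. \<forall>j\<in>{..<n}. f (block j \<beta>)"])
  show "hard UNIV (n * d) (\<lambda>\<beta>. \<forall>j\<in>{..<n}. f (block j \<beta>)) \<and> 0 < n * d" for i
    using assms by (intro conjI hard_All[where e = "\<lambda>_. d"]) auto
qed (use assms in \<open>auto simp: power2_eq_square\<close>)

definition tuple :: "nat \<Rightarrow> ((nat \<Rightarrow> bool) \<Rightarrow> 'b) \<Rightarrow> (nat \<Rightarrow> bool) \<Rightarrow> 'b list" where
  "tuple c f \<alpha> = map (\<lambda>i. f (block i \<alpha>)) [0..<c]"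

text \<open>Each copy is played by its own strategy. The budget does not grow with \<open>c\<close>,
  but every list of values stays possible, which is the freedom of addresses that the cheat sheet
  argument relies on.\<close>

lemma hard_tuple:
  fixes f :: "(nat \<Rightarrow> bool) \<Rightarrow> 'b"
  assumes "hard UNIV d f"
  shows "hard {xs. length xs = c} d (tuple c f)"
proof -
  \<comment> \<open>The copies get restricted differently during play, so the induction runs over
    families \<open>h\<close>.\<close>
  have "hard {xs. length xs = c} d (\<lambda>\<alpha>. map (\<lambda>i. h i (block i \<alpha>)) [0..<c])"
    if "\<And>i. hard UNIV d (h i)" for h :: "nat \<Rightarrow> (nat \<Rightarrow> bool) \<Rightarrow> 'b"
    using that
  proof (induction d arbitrary: h)
    case (Suc d)
    have "\<exists>\<alpha>. h i \<alpha> = y" for i y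
      using hard_Suc_attains[OF Suc.prems] by blast
    then obtain a where a: "\<And>i y. h i (a i y) = y"
      by metis
    have "xs = map (\<lambda>i. h i (block i (join (\<lambda>i. a i (xs ! i))))) [0..<length xs]" for xs
      by (simp add: a map_nth)
    then have "{xs. length xs = c} \<subseteq> range (\<lambda>\<alpha>. map (\<lambda>i. h i (block i \<alpha>)) [0..<c])"
      by blast
    moreover have "\<exists>b. hard {xs. length xs = c} d
        (\<lambda>\<alpha>. map (\<lambda>i. h i (block i (\<alpha>(v := b)))) [0..<c])" for v
    proof -
      obtain j x where v: "v = prod_encode (j, x)"
        by (metis prod_decode_inverse surj_pair)
      obtain b where b: "hard UNIV d (\<lambda>\<beta>. h j (\<beta>(x := b)))"
        using Suc.prems[of j] by auto
      define h' where "h' = h(j := (\<lambda>\<beta>. h j (\<beta>(x := b))))"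
      have "(\<lambda>\<alpha>. map (\<lambda>i. h i (block i (\<alpha>(v := b)))) [0..<c])
          = (\<lambda>\<alpha>. map (\<lambda>i. h' i (block i \<alpha>)) [0..<c])"
        by (auto simp: h'_def v block_upd fun_eq_iff)
      moreover have "hard {xs. length xs = c} d (\<lambda>\<alpha>. map (\<lambda>i. h' i (block i \<alpha>)) [0..<c])"
        using b Suc.prems[THEN hard_SucD] by (intro Suc.IH) (simp add: h'_def)
      ultimately show ?thesis
        by (intro exI[of _ b]) simp
    qed
    ultimately show ?case
      by simp
  qed simp
  from this[of "\<lambda>_. f"] assms show ?thesis
    by (simp add: tuple_def[abs_def])
qed

section \<open>Cheat sheets\<close>

definition certifies :: "((nat \<Rightarrow> bool) \<Rightarrow> 'b) \<Rightarrow> (nat \<Rightarrow> bool) \<Rightarrow> nat set \<Rightarrow> bool" where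
  "certifies g \<alpha> S \<longleftrightarrow> (\<forall>\<beta>. (\<forall>x\<in>S. \<beta> x = \<alpha> x) \<longrightarrow> g \<beta> = g \<alpha>)"

text \<open>Data and sheets are separate arguments so that answers about them can be recorded
  separately. A sheet names only a set of variables; their values are read from the data.\<close>

definition cheat_core ::
  "((nat \<Rightarrow> bool) \<Rightarrow> nat set option) \<Rightarrow> ((nat \<Rightarrow> bool) \<Rightarrow> 'a) \<Rightarrow> (nat \<Rightarrow> bool)
    \<Rightarrow> ('a \<Rightarrow> nat \<Rightarrow> bool) \<Rightarrow> bool" where
  "cheat_core dec g \<beta> \<sigma> =
     (case dec (\<sigma> (g \<beta>)) of None \<Rightarrow> False | Some S \<Rightarrow> certifies g \<beta> S)"

definition cheat_sheet ::
  "((nat \<Rightarrow> bool) \<Rightarrow> nat set option) \<Rightarrow> ((nat \<Rightarrow> bool) \<Rightarrow> 'a::countable) \<Rightarrow> (nat \<Rightarrow> bool)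
    \<Rightarrow> bool" where
  "cheat_sheet dec g \<alpha> = cheat_core dec g (block 0 \<alpha>) (\<lambda>y. block (Suc (to_nat y)) \<alpha>)"

text \<open>Fewer than \<open>card A\<close> queries leave some sheet untouched. As long as every value of \<open>g\<close>
  is still possible, the value may be the address of that sheet.\<close>

lemma hard_cheat_sheet:
  fixes g :: "(nat \<Rightarrow> bool) \<Rightarrow> 'a::countable"
  assumes "hard A d g" "finite A" "d \<le> card A"
    and None: "None \<in> range dec"
    and Some: "\<And>\<alpha>. \<exists>S. Some S \<in> range dec \<and> certifies g \<alpha> S"
  shows "hard UNIV d (cheat_sheet dec g)"
proof -
  \<comment> \<open>\<open>r\<close> and \<open>t\<close> record the answers about the data and the
    sheets, and \<open>T\<close> contains the addresses of all sheets queried so far. Each query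
    lowers \<open>d\<close> by one and adds at most one address to \<open>T\<close>.\<close>
  have "hard UNIV d (\<lambda>\<alpha>. cheat_core dec g (r (block 0 \<alpha>))
      (\<lambda>y. t y (block (Suc (to_nat y)) \<alpha>)))"
    if "hard A d (\<lambda>\<alpha>. g (r \<alpha>))" "finite T" "card T + d \<le> card A" "\<And>y. y \<notin> T \<Longrightarrow> t y = id"
    for r t T
    using that
  proof (induction d arbitrary: r t T)
    case (Suc d)
    note prems = Suc.prems
    have "\<not> A \<subseteq> T"
      using prems(2,3) card_mono[of T A] by auto
    then obtain y where y: "y \<in> A" "y \<notin> T"
      by blast
    then obtain \<beta> where \<beta>: "g (r \<beta>) = y"
      using hard_Suc_attains[OF prems(1)] by blast
    obtain S s1 where s1: "Some S = dec s1" "certifies g (r \<beta>) S"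
      using Some[of "r \<beta>"] by auto
    obtain s0 where s0: "None = dec s0"
      using None by auto
    \<comment> \<open>The sheet at the untouched address \<open>y\<close> can still be filled with a
      valid certificate or with a code of \<open>None\<close>, so both values are attained.\<close>
    have "b \<in> range (\<lambda>\<alpha>. cheat_core dec g (r (block 0 \<alpha>))
        (\<lambda>y. t y (block (Suc (to_nat y)) \<alpha>)))" for b
    proof
      show "b = cheat_core dec g (r (block 0 (join (case_nat \<beta> (\<lambda>_. if b then s1 else s0)))))
        (\<lambda>y. t y (block (Suc (to_nat y)) (join (case_nat \<beta> (\<lambda>_. if b then s1 else s0)))))"
        using \<beta> y prems(4) s1 s0[symmetric] by (simp add: cheat_core_def flip: s1(1))
    qed simp
    moreover have "\<exists>b. hard UNIV d (\<lambda>\<alpha>. cheat_core dec g (r (block 0 (\<alpha>(v := b))))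
        (\<lambda>y. t y (block (Suc (to_nat y)) (\<alpha>(v := b)))))" for v
    proof -
      obtain j x where v: "v = prod_encode (j, x)"
        by (metis prod_decode_inverse surj_pair)
      show ?thesis
      proof (cases j)
        case 0
        obtain b where b: "hard A d (\<lambda>\<alpha>. g (r (\<alpha>(x := b))))"
          using prems(1) by auto
        have "hard UNIV d (\<lambda>\<alpha>. cheat_core dec g (r ((block 0 \<alpha>)(x := b)))
            (\<lambda>y. t y (block (Suc (to_nat y)) \<alpha>)))"
          using prems b by (intro Suc.IH[of "\<lambda>\<beta>. r (\<beta>(x := b))"]) auto
        then show ?thesis
          unfolding v 0 by (intro exI[of _ b]) (simp add: block_upd)
      next
        case (Suc k)
        \<comment> \<open>Any answer about a sheet will do, since its address is struck off;
          \<open>to_nat\<close> is injective, so at most one address is lost.\<close>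
        define t' where "t' y = (if to_nat y = k then \<lambda>s. t y (s(x := False)) else t y)" for y :: 'a
        define T' where "T' = T \<union> {y. to_nat y = k}"
        have sub: "{y :: 'a. to_nat y = k} \<subseteq> {from_nat k}"
          by auto
        have fin: "finite {y :: 'a. to_nat y = k}"
          by (rule finite_subset[OF sub]) simp
        have "card {y :: 'a. to_nat y = k} \<le> 1"
          using card_mono[OF _ sub] by simp
        then have "card T' \<le> card T + 1"
          unfolding T'_def using card_Un_le[of T "{y. to_nat y = k}"] by linarith
        then have "hard UNIV d (\<lambda>\<alpha>. cheat_core dec g (r (block 0 \<alpha>))
            (\<lambda>y. t' y (block (Suc (to_nat y)) \<alpha>)))"
          using prems fin hard_SucD[OF prems(1)]
          by (intro Suc.IH[of r T']) (auto simp: T'_def t'_def)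
        moreover have "(\<lambda>y. t y (block (Suc (to_nat y)) (\<alpha>(v := False))))
            = (\<lambda>y. t' y (block (Suc (to_nat y)) \<alpha>))" for \<alpha>
          unfolding v Suc by (auto simp: block_upd t'_def)
        ultimately show ?thesis
          unfolding v Suc by (intro exI[of _ False]) (simp add: block_upd)
      qed
    qed
    ultimately show ?case
      by auto
  qed simp
  from this[of id "{}" "\<lambda>_. id"] assms show ?thesis
    by (simp add: cheat_sheet_def[abs_def])
qed

section \<open>Certificates and selectors\<close>

definition has_certs :: "nat set \<Rightarrow> ((nat \<Rightarrow> bool) \<Rightarrow> 'b) \<Rightarrow> nat \<Rightarrow> bool" where
  "has_certs V g c \<longleftrightarrow> (\<forall>\<alpha>. \<exists>S\<subseteq>V. card S \<le> c \<and> certifies g \<alpha> S)"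

lemma has_certsE:
  assumes "has_certs V g c"
  obtains T where "\<And>\<alpha>. T \<alpha> \<subseteq> V" "\<And>\<alpha>. card (T \<alpha>) \<le> c" "\<And>\<alpha>. certifies g \<alpha> (T \<alpha>)"
proof -
  have "\<exists>T. \<forall>\<alpha>. T \<alpha> \<subseteq> V \<and> card (T \<alpha>) \<le> c \<and> certifies g \<alpha> (T \<alpha>)"
    using assms unfolding has_certs_def by (intro choice) auto
  then show ?thesis
    using that by auto
qed

text \<open>Selectors are the unambiguous certificates of query complexity.\<close>

definition selector :: "nat set \<Rightarrow> ((nat \<Rightarrow> bool) \<Rightarrow> 'b) \<Rightarrow> ((nat \<Rightarrow> bool) \<Rightarrow> nat set) \<Rightarrow> bool" where
  "selector V g S \<longleftrightarrow>
     (\<forall>\<alpha>. S \<alpha> \<subseteq> V \<and> (\<forall>\<beta>. (\<forall>x\<in>S \<alpha>. \<beta> x = \<alpha> x) \<longrightarrow> S \<beta> = S \<alpha> \<and> g \<beta> = g \<alpha>))"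

lemma selector_subset: "selector V g S \<Longrightarrow> S \<alpha> \<subseteq> V"
  unfolding selector_def by blast

lemma selector_agree:
  assumes "selector V g S" "\<And>x. x \<in> S \<alpha> \<Longrightarrow> \<beta> x = \<alpha> x"
  shows "S \<beta> = S \<alpha>" "g \<beta> = g \<alpha>"
  using assms unfolding selector_def by blast+

lemma selector_comp:
  assumes "selector V g S"
  shows "selector V (\<lambda>\<alpha>. h (g \<alpha>)) S"
  unfolding selector_def
proof (intro allI conjI impI)
  fix \<alpha> \<beta>
  show "S \<alpha> \<subseteq> V"
    by (rule selector_subset[OF assms])
  assume "\<forall>x\<in>S \<alpha>. \<beta> x = \<alpha> x"
  then show "S \<beta> = S \<alpha>" "h (g \<beta>) = h (g \<alpha>)"
    using selector_agree[OF assms, of \<alpha> \<beta>] by auto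
qed

section \<open>Variables inside blocks\<close>

definition shift :: "nat \<Rightarrow> nat set \<Rightarrow> nat set" where
  "shift i S = (\<lambda>x. prod_encode (i, x)) ` S"

definition blocks :: "nat \<Rightarrow> nat set \<Rightarrow> nat set" where
  "blocks c V = (\<Union>i<c. shift i V)"

lemma agree_shift: "(\<forall>v\<in>shift i S. \<beta> v = \<alpha> v) \<longleftrightarrow> (\<forall>x\<in>S. block i \<beta> x = block i \<alpha> x)"
  by (simp add: shift_def block_def)

lemma agree_UN_shift:
  assumes "\<forall>v\<in>\<Union>i\<in>I. shift (a i) (S i). \<beta> v = \<alpha> v" "i \<in> I"
  shows "\<forall>x\<in>S i. block (a i) \<beta> x = block (a i) \<alpha> x"
  unfolding agree_shift[symmetric] using assms by blast

lemma shift_mono: "S \<subseteq> T \<Longrightarrow> shift i S \<subseteq> shift i T"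
  by (auto simp: shift_def)

lemma card_shift: "card (shift i S) = card S"
  unfolding shift_def by (rule card_image) (simp add: inj_on_def)

lemma finite_shift: "finite S \<Longrightarrow> finite (shift i S)"
  by (simp add: shift_def)

lemma finite_blocks: "finite V \<Longrightarrow> finite (blocks c V)"
  by (simp add: blocks_def finite_shift)

lemma card_UN_shift_le:
  assumes "finite I" "\<And>i. i \<in> I \<Longrightarrow> card (S i) \<le> k"
  shows "card (\<Union>i\<in>I. shift (a i) (S i)) \<le> card I * k"
proof -
  have "card (\<Union>i\<in>I. shift (a i) (S i)) \<le> (\<Sum>i\<in>I. card (shift (a i) (S i)))"
    by (rule card_UN_le[OF assms(1)])
  also have "\<dots> \<le> (\<Sum>i\<in>I. k)"
    using assms(2) by (intro sum_mono) (simp add: card_shift)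
  finally show ?thesis
    by simp
qed

lemma card_blocks: "card (blocks c V) \<le> c * card V"
  unfolding blocks_def using card_UN_shift_le[of "{..<c}" "\<lambda>_. V" "card V" "\<lambda>i. i"] by simp

lemma selector_tuple:
  assumes "selector V f S"
  shows "selector (blocks c V) (tuple c f) (\<lambda>\<alpha>. \<Union>i<c. shift i (S (block i \<alpha>)))"
  unfolding selector_def
proof (intro allI conjI impI)
  fix \<alpha> \<beta>
  show "(\<Union>i<c. shift i (S (block i \<alpha>))) \<subseteq> blocks c V"
    unfolding blocks_def by (intro UN_mono shift_mono selector_subset[OF assms]) auto
  assume "\<forall>x\<in>\<Union>i<c. shift i (S (block i \<alpha>)). \<beta> x = \<alpha> x"
  then have "\<forall>x\<in>S (block i \<alpha>). block i \<beta> x = block i \<alpha> x" if "i < c" for i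
    using that by (intro agree_UN_shift) auto
  then have *: "S (block i \<beta>) = S (block i \<alpha>)" "f (block i \<beta>) = f (block i \<alpha>)" if "i < c" for i
    using that selector_agree[OF assms, of "block i \<alpha>" "block i \<beta>"] by blast+
  show "(\<Union>i<c. shift i (S (block i \<beta>))) = (\<Union>i<c. shift i (S (block i \<alpha>)))"
    using * by simp
  show "tuple c f \<beta> = tuple c f \<alpha>"
    using * by (simp add: tuple_def)
qed

lemma has_certs_tuple:
  assumes "has_certs V f k"
  shows "has_certs (blocks c V) (tuple c f) (c * k)"
  unfolding has_certs_def
proof
  fix \<alpha>
  obtain U where U: "\<And>\<alpha>. U \<alpha> \<subseteq> V" "\<And>\<alpha>. card (U \<alpha>) \<le> k" "\<And>\<alpha>. certifies f \<alpha> (U \<alpha>)"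
    by (rule has_certsE[OF assms], rule that)
  define T where "T i = U (block i \<alpha>)" for i
  have T: "\<And>i. T i \<subseteq> V" "\<And>i. card (T i) \<le> k" "\<And>i. certifies f (block i \<alpha>) (T i)"
    using U by (auto simp: T_def)
  show "\<exists>S\<subseteq>blocks c V. card S \<le> c * k \<and> certifies (tuple c f) \<alpha> S"
  proof (intro exI conjI)
    show "(\<Union>i<c. shift i (T i)) \<subseteq> blocks c V"
      unfolding blocks_def by (intro UN_mono shift_mono T(1)) auto
    show "card (\<Union>i<c. shift i (T i)) \<le> c * k"
      using card_UN_shift_le[of "{..<c}" T k "\<lambda>i. i"] T(2) by simp
    show "certifies (tuple c f) \<alpha> (\<Union>i<c. shift i (T i))"
      unfolding certifies_def
    proof (intro allI impI)
      fix \<beta> assume "\<forall>x\<in>\<Union>i<c. shift i (T i). \<beta> x = \<alpha> x"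
      then have "\<forall>x\<in>T i. block i \<beta> x = block i \<alpha> x" if "i < c" for i
        using that by (intro agree_UN_shift) auto
      then show "tuple c f \<beta> = tuple c f \<alpha>"
        using T(3) by (simp add: certifies_def tuple_def)
    qed
  qed
qed

section \<open>Certificates and selectors under or-and composition\<close>

definition conj_blocks :: "nat \<Rightarrow> ((nat \<Rightarrow> bool) \<Rightarrow> bool) \<Rightarrow> (nat \<Rightarrow> bool) \<Rightarrow> bool" where
  "conj_blocks n f \<beta> = (\<forall>j<n. f (block j \<beta>))"

text \<open>In this form \<open>selector_tuple\<close> and \<open>selector_comp\<close> supply the
  selector: the selector of every disjunct is read.\<close>

lemma or_and_eq: "or_and n f = (\<lambda>\<alpha>. True \<in> set (tuple n (conj_blocks n f) \<alpha>))"
  by (auto simp: or_and_def tuple_def conj_blocks_def fun_eq_iff)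

text \<open>All blocks up to the first false one are read, so only one certificate of the value
  false is paid for.\<close>

lemma selector_conj_blocks:
  fixes n f
  defines "J \<equiv> \<lambda>\<alpha>. {j. j < n \<and> (\<forall>k<j. f (block k \<alpha>))}"
  assumes S: "selector V f S" and card: "\<And>\<alpha>. card (S \<alpha>) \<le> a + (if f \<alpha> then 0 else u)"
  shows "selector (blocks n V) (conj_blocks n f) (\<lambda>\<alpha>. \<Union>j\<in>J \<alpha>. shift j (S (block j \<alpha>)))"
    and "card (\<Union>j\<in>J \<alpha>. shift j (S (block j \<alpha>))) \<le> n * a + u"
proof -
  show "selector (blocks n V) (conj_blocks n f) (\<lambda>\<alpha>. \<Union>j\<in>J \<alpha>. shift j (S (block j \<alpha>)))"
    unfolding selector_def
  proof (intro allI conjI impI)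
    fix \<alpha> \<beta>
    show "(\<Union>j\<in>J \<alpha>. shift j (S (block j \<alpha>))) \<subseteq> blocks n V"
      unfolding blocks_def J_def by (intro UN_mono shift_mono selector_subset[OF S]) auto
    assume "\<forall>x\<in>\<Union>j\<in>J \<alpha>. shift j (S (block j \<alpha>)). \<beta> x = \<alpha> x"
    then have "\<forall>x\<in>S (block j \<alpha>). block j \<beta> x = block j \<alpha> x" if "j \<in> J \<alpha>" for j
      using that by (intro agree_UN_shift)
    then have *: "S (block j \<beta>) = S (block j \<alpha>)" "f (block j \<beta>) = f (block j \<alpha>)"
      if "j \<in> J \<alpha>" for j
      using that selector_agree[OF S, of "block j \<alpha>" "block j \<beta>"] by blast+
    \<comment> \<open>Agreement is passed along the prefix: while all earlier blocks are true, block
      \<open>j\<close> belongs to \<open>J \<alpha>\<close>, and the variables read there fix its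
      value.\<close>
    have pre: "j < n \<Longrightarrow> (\<forall>k<j. f (block k \<beta>)) \<longleftrightarrow> (\<forall>k<j. f (block k \<alpha>))" for j
    proof (induction j)
      case (Suc j)
      then show ?case
        using *(2)[of j] by (auto simp: J_def less_Suc_eq)
    qed simp
    have J: "J \<beta> = J \<alpha>"
      using pre by (auto simp: J_def)
    show "(\<Union>j\<in>J \<beta>. shift j (S (block j \<beta>))) = (\<Union>j\<in>J \<alpha>. shift j (S (block j \<alpha>)))"
      unfolding J using * by simp
    \<comment> \<open>If some block is false, then the first such block lies in \<open>J\<close>, so
      the blocks in \<open>J\<close> decide the conjunction.\<close>
    have J_iff: "conj_blocks n f \<gamma> \<longleftrightarrow> (\<forall>j\<in>J \<gamma>. f (block j \<gamma>))" for \<gamma>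
    proof
      assume r: "\<forall>j\<in>J \<gamma>. f (block j \<gamma>)"
      have "j < n \<Longrightarrow> f (block j \<gamma>)" for j
      proof (induction j rule: less_induct)
        case (less j)
        then have "j \<in> J \<gamma>"
          by (simp add: J_def)
        then show ?case
          using r by blast
      qed
      then show "conj_blocks n f \<gamma>"
        by (simp add: conj_blocks_def)
    qed (auto simp: conj_blocks_def J_def)
    show "conj_blocks n f \<beta> = conj_blocks n f \<alpha>"
      unfolding J_iff J using * by simp
  qed
  have fin: "finite (J \<alpha>)"
    by (simp add: J_def)
  let ?Z = "{j \<in> J \<alpha>. \<not> f (block j \<alpha>)}"
  \<comment> \<open>The earlier of two false blocks would keep the later one out of
    \<open>J\<close>.\<close>
  have "j = k" if "j \<in> ?Z" "k \<in> ?Z" for j k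
    using that by (cases j k rule: linorder_cases) (auto simp: J_def)
  then have "card ?Z \<le> 1"
    using fin by (simp add: card_le_Suc0_iff_eq)
  have "card (J \<alpha>) \<le> card {..<n}"
    by (rule card_mono) (auto simp: J_def)
  have "card (\<Union>j\<in>J \<alpha>. shift j (S (block j \<alpha>))) \<le> (\<Sum>j\<in>J \<alpha>. card (shift j (S (block j \<alpha>))))"
    by (rule card_UN_le[OF fin])
  also have "\<dots> \<le> (\<Sum>j\<in>J \<alpha>. a + (if \<not> f (block j \<alpha>) then u else 0))"
  proof (rule sum_mono)
    show "card (shift j (S (block j \<alpha>))) \<le> a + (if \<not> f (block j \<alpha>) then u else 0)" for j
      using card[of "block j \<alpha>"] by (simp add: card_shift split: if_splits)
  qed
  also have "\<dots> = card (J \<alpha>) * a + card ?Z * u"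
    using fin by (simp add: sum.distrib sum.If_cases Int_def)
  also have "\<dots> \<le> n * a + 1 * u"
    using \<open>card ?Z \<le> 1\<close> \<open>card (J \<alpha>) \<le> card {..<n}\<close> by (intro add_mono mult_le_mono1) auto
  finally show "card (\<Union>j\<in>J \<alpha>. shift j (S (block j \<alpha>))) \<le> n * a + u"
    by simp
qed

text \<open>This is where cheap true values pay off: the extra cost \<open>u\<close> of a false
  value enters once per disjunct instead of once per copy of \<open>f\<close>.\<close>

lemma selector_or_and:
  assumes "selector V f S" and "\<And>\<alpha>. card (S \<alpha>) \<le> a + (if f \<alpha> then 0 else u)"
  obtains S' where "selector (blocks n (blocks n V)) (or_and n f) S'"
    "\<And>\<alpha>. card (S' \<alpha>) \<le> n * (n * a + u)"
proof -
  from selector_conj_blocks[OF assms, where n = n] obtain S1 where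
    S1: "selector (blocks n V) (conj_blocks n f) S1" "\<And>\<alpha>. card (S1 \<alpha>) \<le> n * a + u"
    by blast
  show thesis
  proof
    show "selector (blocks n (blocks n V)) (or_and n f) (\<lambda>\<alpha>. \<Union>i<n. shift i (S1 (block i \<alpha>)))"
      unfolding or_and_eq by (rule selector_comp[OF selector_tuple[OF S1(1)]])
    show "card (\<Union>i<n. shift i (S1 (block i \<alpha>))) \<le> n * (n * a + u)" for \<alpha>
      using card_UN_shift_le[of "{..<n}" "\<lambda>i. S1 (block i \<alpha>)" "n * a + u" "\<lambda>i. i"] S1(2) by simp
  qed
qed

text \<open>Certifying \<open>n\<close> of the copies suffices: all conjuncts of one true disjunct,
  or one false conjunct in every disjunct.\<close>

lemma has_certs_or_and:
  assumes "has_certs V f k"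
  shows "has_certs (blocks n (blocks n V)) (or_and n f) (n * k)"
  unfolding has_certs_def
proof
  fix \<alpha>
  obtain U where U: "\<And>\<alpha>. U \<alpha> \<subseteq> V" "\<And>\<alpha>. card (U \<alpha>) \<le> k" "\<And>\<alpha>. certifies f \<alpha> (U \<alpha>)"
    by (rule has_certsE[OF assms], rule that)
  define T where "T i j = U (block j (block i \<alpha>))" for i j
  have T: "\<And>i j. T i j \<subseteq> V" "\<And>i j. card (T i j) \<le> k"
    "\<And>i j. certifies f (block j (block i \<alpha>)) (T i j)"
    using U by (auto simp: T_def)
  have sub: "shift i (shift j (T i j)) \<subseteq> blocks n (blocks n V)" if "i < n" "j < n" for i j
    unfolding blocks_def using that shift_mono[OF T(1)] by (fastforce simp: shift_def)
  have card: "card (shift j (T i j)) \<le> k" for i j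
    using T(2) by (simp add: card_shift)
  show "\<exists>S\<subseteq>blocks n (blocks n V). card S \<le> n * k \<and> certifies (or_and n f) \<alpha> S"
  proof (cases "or_and n f \<alpha>")
    case True
    then obtain i where i: "i < n" "\<And>j. j < n \<Longrightarrow> f (block j (block i \<alpha>))"
      by (auto simp: or_and_def)
    show ?thesis
    proof (intro exI conjI)
      show "(\<Union>j<n. shift i (shift j (T i j))) \<subseteq> blocks n (blocks n V)"
        by (intro UN_least sub i(1)) auto
      show "card (\<Union>j<n. shift i (shift j (T i j))) \<le> n * k"
        using card_UN_shift_le[of "{..<n}" "\<lambda>j. shift j (T i j)" k "\<lambda>_. i"] card by simp
      show "certifies (or_and n f) \<alpha> (\<Union>j<n. shift i (shift j (T i j)))"
        unfolding certifies_def
      proof (intro allI impI)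
        fix \<beta> assume "\<forall>x\<in>\<Union>j<n. shift i (shift j (T i j)). \<beta> x = \<alpha> x"
        then have "\<forall>v\<in>shift j (T i j). block i \<beta> v = block i \<alpha> v" if "j < n" for j
          using that by (intro agree_UN_shift) auto
        then have "\<forall>x\<in>T i j. block j (block i \<beta>) x = block j (block i \<alpha>) x" if "j < n" for j
          using that by (simp add: agree_shift)
        then have "f (block j (block i \<beta>))" if "j < n" for j
          using that T(3) i(2) unfolding certifies_def by metis
        then have "or_and n f \<beta>"
          using i(1) by (auto simp: or_and_def)
        then show "or_and n f \<beta> = or_and n f \<alpha>"
          using True by simp
      qed
    qed
  next
    case False
    then have "\<forall>i. \<exists>j. i < n \<longrightarrow> j < n \<and> \<not> f (block j (block i \<alpha>))"
      by (auto simp: or_and_def)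
    then obtain z where z: "\<And>i. i < n \<Longrightarrow> z i < n" "\<And>i. i < n \<Longrightarrow> \<not> f (block (z i) (block i \<alpha>))"
      by metis
    show ?thesis
    proof (intro exI conjI)
      show "(\<Union>i<n. shift i (shift (z i) (T i (z i)))) \<subseteq> blocks n (blocks n V)"
        by (intro UN_least sub z(1)) auto
      show "card (\<Union>i<n. shift i (shift (z i) (T i (z i)))) \<le> n * k"
        using card_UN_shift_le[of "{..<n}" "\<lambda>i. shift (z i) (T i (z i))" k "\<lambda>i. i"] card by simp
      show "certifies (or_and n f) \<alpha> (\<Union>i<n. shift i (shift (z i) (T i (z i))))"
        unfolding certifies_def
      proof (intro allI impI)
        fix \<beta> assume "\<forall>x\<in>\<Union>i<n. shift i (shift (z i) (T i (z i))). \<beta> x = \<alpha> x"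
        then have "\<forall>v\<in>shift (z i) (T i (z i)). block i \<beta> v = block i \<alpha> v" if "i < n" for i
          using that by (intro agree_UN_shift) auto
        then have "\<forall>x\<in>T i (z i). block (z i) (block i \<beta>) x = block (z i) (block i \<alpha>) x"
          if "i < n" for i
          using that by (simp add: agree_shift)
        then have "\<not> f (block (z i) (block i \<beta>))" if "i < n" for i
          using that T(3) z(2) unfolding certifies_def by metis
        then have "\<not> or_and n f \<beta>"
          using z(1) by (auto simp: or_and_def)
        then show "or_and n f \<beta> = or_and n f \<alpha>"
          using False by simp
      qed
    qed
  qed
qed

section \<open>Coding certificates by bit strings\<close>

text \<open>Each such subset is the set of entries of a list of length \<open>k\<close>, with
  \<open>None\<close> as padding for smaller subsets.\<close>

lemma card_bounded_subsets:
  assumes "finite W"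
  shows "card {S. S \<subseteq> W \<and> card S \<le> k} \<le> (card W + 1) ^ k"
proof -
  let ?L = "{xs. set xs \<subseteq> insert None (Some ` W) \<and> length xs = k}"
  let ?h = "\<lambda>xs. {x. Some x \<in> set xs}"
  have "{S. S \<subseteq> W \<and> card S \<le> k} \<subseteq> ?h ` ?L"
  proof
    fix S assume "S \<in> {S. S \<subseteq> W \<and> card S \<le> k}"
    then have S: "S \<subseteq> W" "card S \<le> k"
      by auto
    then obtain ys where ys: "set ys = S" "distinct ys"
      using finite_distinct_list assms finite_subset by metis
    then have "length ys \<le> k"
      using S distinct_card by metis
    then show "S \<in> ?h ` ?L"
      using ys S by (intro image_eqI[of _ _ "map Some ys @ replicate (k - length ys) None"])
        (auto split: if_splits)
  qed
  then have "card {S. S \<subseteq> W \<and> card S \<le> k} \<le> card ?L"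
    using assms by (intro surj_card_le finite_lists_length_eq) auto
  also have "\<dots> = (card W + 1) ^ k"
    using assms by (simp add: card_lists_length_eq card_image)
  finally show ?thesis .
qed

text \<open>Lets the first \<open>M\<close> bits of a sheet name any element of \<open>X\<close>,
  through an injection of \<open>X\<close> into the subsets of these positions.\<close>

lemma decoder_exists:
  assumes "finite X" "x0 \<in> X" "card X \<le> 2 ^ M"
  obtains dec :: "(nat \<Rightarrow> bool) \<Rightarrow> 'x" where "range dec = X"
    "\<forall>s s'. (\<forall>q<M. s q = s' q) \<longrightarrow> dec s = dec s'"
proof -
  have "card X \<le> card (Pow {..<M})"
    using assms(3) by (simp add: card_Pow)
  then have "\<exists>e. e ` X \<subseteq> Pow {..<M} \<and> inj_on e X"
    by (intro card_le_inj assms(1)) auto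
  then obtain e where e: "e ` X \<subseteq> Pow {..<M}" "inj_on e X"
    by blast
  define Q where "Q s = {q. q < M \<and> s q}" for s
  \<comment> \<open>Bit strings that code nothing are sent to \<open>x0\<close>, which keeps the
    range equal to \<open>X\<close>.\<close>
  define dec where "dec s = (if Q s \<in> e ` X then inv_into X e (Q s) else x0)" for s
  show thesis
  proof
    show "range dec = X"
    proof (intro equalityI subsetI)
      fix x assume "x \<in> range dec"
      then obtain s where s: "x = dec s"
        by blast
      show "x \<in> X"
        unfolding s dec_def using assms(2) inv_into_into[of "Q s" e X] by presburger
    next
      fix x assume x: "x \<in> X"
      then have "Q (\<lambda>q. q \<in> e x) = e x"
        using e(1) unfolding Q_def by blast
      then have "dec (\<lambda>q. q \<in> e x) = x"
        using x e(2) by (simp add: dec_def)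
      then show "x \<in> range dec"
        by (metis rangeI)
    qed
    show "\<forall>s s'. (\<forall>q<M. s q = s' q) \<longrightarrow> dec s = dec s'"
    proof (intro allI impI)
      fix s s' :: "nat \<Rightarrow> bool" assume "\<forall>q<M. s q = s' q"
      then have "Q s = Q s'"
        unfolding Q_def by blast
      then show "dec s = dec s'"
        by (simp add: dec_def)
    qed
  qed
qed

lemma certifies_agree:
  assumes "\<And>x. x \<in> S \<Longrightarrow> \<beta> x = \<alpha> x" "g \<beta> = g \<alpha>"
  shows "certifies g \<beta> S \<longleftrightarrow> certifies g \<alpha> S"
  using assms by (auto simp: certifies_def)

text \<open>If the value is true, then the cheat sheet itself certifies its address, and the
  expensive selector of \<open>g\<close> is not needed.\<close>

lemma cheat_sheet_exists:
  fixes g :: "(nat \<Rightarrow> bool) \<Rightarrow> 'a::countable"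
  assumes W: "finite W" and A: "finite A" "range g \<subseteq> A" and M: "(card W + 1) ^ k + 1 \<le> 2 ^ M"
    and certs: "has_certs W g k"
    and S: "selector W g S" "\<And>\<alpha>. card (S \<alpha>) \<le> u"
    and hard: "hard A d g" "d \<le> card A"
  obtains V f S' where "finite V" "card V \<le> card W + card A * M" "hard UNIV d f"
    "has_certs V f (M + 2 * k)" "selector V f S'"
    "\<And>\<alpha>. card (S' \<alpha>) \<le> M + k + (if f \<alpha> then 0 else u)"
proof -
  \<comment> \<open>\<open>None\<close> serves as the code of an invalid sheet, so that false is
    attainable; it accounts for the \<open>+ 1\<close> in the hypothesis on
    \<open>M\<close>.\<close>
  define X where "X = insert None (Some ` {T. T \<subseteq> W \<and> card T \<le> k})"
  have finP: "finite {T. T \<subseteq> W \<and> card T \<le> k}"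
    using W by simp
  have "card X = Suc (card {T. T \<subseteq> W \<and> card T \<le> k})"
    unfolding X_def using finP by (subst card_insert_disjoint) (auto simp: card_image)
  also have "\<dots> \<le> 2 ^ M"
    using card_bounded_subsets[OF W, of k] M by linarith
  finally have cardX: "card X \<le> 2 ^ M" .
  have X: "finite X" "None \<in> X"
    unfolding X_def using finP by auto
  obtain dec :: "(nat \<Rightarrow> bool) \<Rightarrow> nat set option" where dec: "range dec = X"
    "\<forall>s s'. (\<forall>q<M. s q = s' q) \<longrightarrow> dec s = dec s'"
    by (rule decoder_exists[OF X cardX], rule that)
  define f where "f = cheat_sheet dec g"
  define adr where "adr \<alpha> = Suc (to_nat (g (block 0 \<alpha>)))" for \<alpha>
  define crt where "crt \<alpha> = (case dec (block (adr \<alpha>) \<alpha>) of None \<Rightarrow> {} | Some T \<Rightarrow> T)" for \<alpha>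
  \<comment> \<open>The sheet at the current address together with the variables it names; a sheet
    decoding to \<open>None\<close> names no variables.\<close>
  define R where "R \<alpha> = shift (adr \<alpha>) {..<M} \<union> shift 0 (crt \<alpha>)" for \<alpha>
  define V where "V = shift 0 W \<union> (\<Union>y\<in>A. shift (Suc (to_nat y)) {..<M})"
  define S' where "S' \<alpha> = R \<alpha> \<union> (if f \<alpha> then {} else shift 0 (S (block 0 \<alpha>)))" for \<alpha>
  have f_iff: "f \<alpha> \<longleftrightarrow> dec (block (adr \<alpha>) \<alpha>) \<noteq> None \<and> certifies g (block 0 \<alpha>) (crt \<alpha>)" for \<alpha>
    by (auto simp: f_def cheat_sheet_def cheat_core_def adr_def crt_def split: option.splits)
  have crt: "crt \<alpha> \<subseteq> W" "card (crt \<alpha>) \<le> k" for \<alpha>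
  proof -
    have "dec (block (adr \<alpha>) \<alpha>) \<in> X"
      using dec(1) by auto
    then show "crt \<alpha> \<subseteq> W" "card (crt \<alpha>) \<le> k"
      by (auto simp: crt_def X_def)
  qed
  have R_sub: "R \<alpha> \<subseteq> V" for \<alpha>
    using shift_mono[OF crt(1), of 0 \<alpha>] A(2) by (auto simp: R_def V_def adr_def)
  have R_card: "card (R \<alpha>) \<le> M + k" for \<alpha>
    unfolding R_def using crt(2)[of \<alpha>] card_Un_le[of "shift (adr \<alpha>) {..<M}" "shift 0 (crt \<alpha>)"]
    by (simp add: card_shift)
  \<comment> \<open>Once the value of \<open>g\<close>, and hence the address, is known,
    \<open>R\<close> settles whether the sheet is valid.\<close>
  have R_agree: "R \<beta> = R \<alpha> \<and> f \<beta> = f \<alpha>"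
    if agr: "\<forall>x\<in>R \<alpha>. \<beta> x = \<alpha> x" and g: "g (block 0 \<beta>) = g (block 0 \<alpha>)" for \<alpha> \<beta>
  proof -
    have adr: "adr \<beta> = adr \<alpha>"
      by (simp add: adr_def g)
    have "\<forall>q\<in>{..<M}. block (adr \<alpha>) \<beta> q = block (adr \<alpha>) \<alpha> q"
      unfolding agree_shift[symmetric] using agr by (auto simp: R_def)
    then have d: "dec (block (adr \<beta>) \<beta>) = dec (block (adr \<alpha>) \<alpha>)"
      unfolding adr by (intro dec(2)[rule_format]) simp
    then have c: "crt \<beta> = crt \<alpha>"
      by (simp add: crt_def)
    have "\<forall>x\<in>crt \<alpha>. block 0 \<beta> x = block 0 \<alpha> x"
      unfolding agree_shift[symmetric] using agr by (auto simp: R_def)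
    then have "certifies g (block 0 \<beta>) (crt \<alpha>) = certifies g (block 0 \<alpha>) (crt \<alpha>)"
      using g by (intro certifies_agree) auto
    then show ?thesis
      unfolding f_iff R_def d c using adr by simp
  qed
  have R_true: "g (block 0 \<beta>) = g (block 0 \<alpha>)" if agr: "\<forall>x\<in>R \<alpha>. \<beta> x = \<alpha> x" and "f \<alpha>" for \<alpha> \<beta>
  proof -
    have "\<forall>x\<in>crt \<alpha>. block 0 \<beta> x = block 0 \<alpha> x"
      unfolding agree_shift[symmetric] using agr by (auto simp: R_def)
    moreover have "certifies g (block 0 \<alpha>) (crt \<alpha>)"
      using \<open>f \<alpha>\<close> by (simp add: f_iff)
    ultimately show ?thesis
      unfolding certifies_def by blast
  qed
  show thesis
  proof
    show "finite V"
      using W A by (auto simp: V_def finite_shift)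
    have "card V \<le> card (shift 0 W) + card (\<Union>y\<in>A. shift (Suc (to_nat y)) {..<M})"
      unfolding V_def by (rule card_Un_le)
    also have "\<dots> \<le> card W + card A * M"
      using card_UN_shift_le[OF A(1), of "\<lambda>_. {..<M}" M "\<lambda>y. Suc (to_nat y)"]
      by (simp add: card_shift)
    finally show "card V \<le> card W + card A * M" .
    show "hard UNIV d f"
      unfolding f_def
    proof (rule hard_cheat_sheet[OF hard(1) A(1) hard(2)])
      show "None \<in> range dec"
        using dec(1) by (simp add: X_def)
      fix \<alpha>
      obtain T where "T \<subseteq> W" "card T \<le> k" "certifies g \<alpha> T"
        using certs by (auto simp: has_certs_def)
      then show "\<exists>T. Some T \<in> range dec \<and> certifies g \<alpha> T"
        using dec(1) by (auto simp: X_def)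
    qed
    show "selector V f S'"
      unfolding selector_def
    proof (intro allI conjI impI)
      fix \<alpha> \<beta>
      show "S' \<alpha> \<subseteq> V"
        using R_sub[of \<alpha>] shift_mono[OF selector_subset[OF S(1)], of 0 "block 0 \<alpha>"]
        by (auto simp: S'_def V_def)
      assume agr: "\<forall>x\<in>S' \<alpha>. \<beta> x = \<alpha> x"
      \<comment> \<open>An invalid sheet need not certify its own address, so in the false case the
        selector of \<open>g\<close> has to pin it down.\<close>
      have sel: "S (block 0 \<beta>) = S (block 0 \<alpha>) \<and> g (block 0 \<beta>) = g (block 0 \<alpha>)" if "\<not> f \<alpha>"
      proof -
        have "\<forall>x\<in>S (block 0 \<alpha>). block 0 \<beta> x = block 0 \<alpha> x"
          unfolding agree_shift[symmetric] using agr that by (auto simp: S'_def)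
        then show ?thesis
          using selector_agree[OF S(1), of "block 0 \<alpha>" "block 0 \<beta>"] by blast
      qed
      have agrR: "\<forall>x\<in>R \<alpha>. \<beta> x = \<alpha> x"
        using agr by (auto simp: S'_def)
      then have "g (block 0 \<beta>) = g (block 0 \<alpha>)"
        using sel R_true by blast
      then have "R \<beta> = R \<alpha>" "f \<beta> = f \<alpha>"
        using R_agree[OF agrR] by auto
      then show "S' \<beta> = S' \<alpha>" "f \<beta> = f \<alpha>"
        using sel by (auto simp: S'_def)
    qed
    show "card (S' \<alpha>) \<le> M + k + (if f \<alpha> then 0 else u)" for \<alpha>
      using R_card[of \<alpha>] S(2)[of "block 0 \<alpha>"]
        card_Un_le[of "R \<alpha>" "shift 0 (S (block 0 \<alpha>))"]
      by (auto simp: S'_def card_shift)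
    show "has_certs V f (M + 2 * k)"
      unfolding has_certs_def
    proof
      fix \<alpha>
      obtain T where T: "T \<subseteq> W" "card T \<le> k" "certifies g (block 0 \<alpha>) T"
        using certs by (auto simp: has_certs_def)
      show "\<exists>T\<subseteq>V. card T \<le> M + 2 * k \<and> certifies f \<alpha> T"
      proof (intro exI conjI)
        \<comment> \<open>An ordinary certificate may use any certificate \<open>T\<close> of
          \<open>g\<close> to fix the address, for both values of \<open>f\<close>; this is the
          second \<open>k\<close>.\<close>
        show "R \<alpha> \<union> shift 0 T \<subseteq> V"
          using R_sub[of \<alpha>] shift_mono[OF T(1), of 0] by (auto simp: V_def)
        show "card (R \<alpha> \<union> shift 0 T) \<le> M + 2 * k"
          using R_card[of \<alpha>] T(2) card_Un_le[of "R \<alpha>" "shift 0 T"] by (simp add: card_shift)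
        show "certifies f \<alpha> (R \<alpha> \<union> shift 0 T)"
          unfolding certifies_def
        proof (intro allI impI)
          fix \<beta> assume agr: "\<forall>x\<in>R \<alpha> \<union> shift 0 T. \<beta> x = \<alpha> x"
          then have "\<forall>x\<in>T. block 0 \<beta> x = block 0 \<alpha> x"
            unfolding agree_shift[symmetric] by auto
          then have "g (block 0 \<beta>) = g (block 0 \<alpha>)"
            using T(3) unfolding certifies_def by blast
          then show "f \<beta> = f \<alpha>"
            using R_agree[of \<alpha> \<beta>] agr by blast
        qed
      qed
    qed
  qed
qed

section \<open>Size of tree-like refutations\<close>

definition falsified_clause :: "(nat \<Rightarrow> bool) \<Rightarrow> nat set \<Rightarrow> nat clause" where
  "falsified_clause \<gamma> S = (\<lambda>x. if \<gamma> x then Neg x else Pos x) ` S"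

text \<open>For a selector this is one clause per subcube of the partition: inputs agreeing on their
  selected set yield the same clause.\<close>

definition selector_cnf :: "((nat \<Rightarrow> bool) \<Rightarrow> nat set) \<Rightarrow> nat cnf" where
  "selector_cnf S = range (\<lambda>\<gamma>. falsified_clause \<gamma> (S \<gamma>))"

lemma card_falsified_clause: "card (falsified_clause \<gamma> S) = card S"
  unfolding falsified_clause_def by (rule card_image) (auto simp: inj_on_def split: if_splits)

lemma falsified_clause_subset:
  "S \<subseteq> V \<Longrightarrow> falsified_clause \<gamma> S \<subseteq> Pos ` V \<union> Neg ` V"
  by (auto simp: falsified_clause_def)

lemma selector_cnf_subset:
  "selector V f S \<Longrightarrow> selector_cnf S \<subseteq> Pow (Pos ` V \<union> Neg ` V)"
  unfolding selector_cnf_def using falsified_clause_subset[OF selector_subset] by blast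

text \<open>If two inputs agreed on the common part of their selected sets, then a third input would
  agree with each of them on its set, so the sets would coincide, and with them the clauses.\<close>

lemma hitting_selector_cnf:
  assumes "finite V" and S: "selector V f S"
  shows "hitting_formula (selector_cnf S)"
proof -
  have fin: "finite (Pos ` V \<union> Neg ` V)"
    using assms(1) by simp
  have "finite (selector_cnf S)"
    using selector_cnf_subset[OF S] fin by (meson finite_Pow_iff finite_subset)
  moreover have "finite C \<and> \<not> tautological C" if "C \<in> selector_cnf S" for C
  proof
    show "finite C"
      using that selector_cnf_subset[OF S] fin finite_subset by blast
    show "\<not> tautological C"
      using that by (auto simp: selector_cnf_def falsified_clause_def tautological_def split: if_splits)
  qed
  moreover have "\<exists>l\<in>C. compl_lit l \<in> D"
    if CD: "C \<in> selector_cnf S" "D \<in> selector_cnf S" "C \<noteq> D" for C D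
  proof -
    obtain \<gamma> \<delta> where C: "C = falsified_clause \<gamma> (S \<gamma>)" and D: "D = falsified_clause \<delta> (S \<delta>)"
      using CD by (auto simp: selector_cnf_def)
    have "\<exists>x\<in>S \<gamma> \<inter> S \<delta>. \<gamma> x \<noteq> \<delta> x"
    proof (rule ccontr)
      assume *: "\<not> (\<exists>x\<in>S \<gamma> \<inter> S \<delta>. \<gamma> x \<noteq> \<delta> x)"
      define \<epsilon> where "\<epsilon> x = (if x \<in> S \<gamma> then \<gamma> x else \<delta> x)" for x
      have "S \<epsilon> = S \<gamma>"
        by (rule selector_agree[OF S]) (simp add: \<epsilon>_def)
      moreover have "S \<epsilon> = S \<delta>"
        using * by (intro selector_agree[OF S]) (auto simp: \<epsilon>_def)
      ultimately have eq: "S \<gamma> = S \<delta>"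
        by simp
      have "falsified_clause \<gamma> (S \<delta>) = falsified_clause \<delta> (S \<delta>)"
        unfolding falsified_clause_def using * eq by (intro image_cong) auto
      then show False
        using CD(3) C D eq by simp
    qed
    then obtain x where x: "x \<in> S \<gamma>" "x \<in> S \<delta>" "\<gamma> x \<noteq> \<delta> x"
      by blast
    show ?thesis
      unfolding C D falsified_clause_def
      using x by (intro bexI[of _ "if \<gamma> x then Neg x else Pos x"]) (auto simp: image_iff)
  qed
  ultimately show ?thesis
    by (simp add: hitting_formula_def is_cnf_def)
qed

text \<open>An assignment falsifies the clause built from itself.\<close>

lemma unsatisfiable_selector_cnf: "unsatisfiable (selector_cnf S)"
  unfolding unsatisfiable_def
proof
  assume "\<exists>\<alpha>. \<forall>C\<in>selector_cnf S. \<exists>l\<in>C. lit_true \<alpha> l"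
  then obtain \<alpha> where "\<exists>l\<in>falsified_clause \<alpha> (S \<alpha>). lit_true \<alpha> l"
    unfolding selector_cnf_def by blast
  then show False
    by (auto simp: falsified_clause_def split: if_splits)
qed

section \<open>Replacing variables by exclusive ors\<close>

definition xor_pairs :: "(nat \<Rightarrow> bool) \<Rightarrow> nat \<Rightarrow> bool" where
  "xor_pairs \<gamma> x \<longleftrightarrow> \<gamma> (2 * x) \<noteq> \<gamma> (2 * x + 1)"

definition pairs :: "nat set \<Rightarrow> nat set" where
  "pairs S = {v. v div 2 \<in> S}"

lemma pairs_eq: "pairs S = (\<lambda>x. 2 * x) ` S \<union> (\<lambda>x. 2 * x + 1) ` S"
proof (intro equalityI subsetI)
  fix v assume "v \<in> pairs S"
  moreover have "v = 2 * (v div 2) \<or> v = 2 * (v div 2) + 1"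
    by presburger
  ultimately show "v \<in> (\<lambda>x. 2 * x) ` S \<union> (\<lambda>x. 2 * x + 1) ` S"
    unfolding pairs_def by blast
qed (auto simp: pairs_def)

lemma finite_pairs: "finite S \<Longrightarrow> finite (pairs S)"
  by (simp add: pairs_eq)

lemma card_pairs: "card (pairs S) \<le> 2 * card S"
proof (cases "finite S")
  case True
  have "card (pairs S) \<le> card ((\<lambda>x. 2 * x) ` S) + card ((\<lambda>x. 2 * x + 1) ` S)"
    unfolding pairs_eq by (rule card_Un_le)
  then show ?thesis
    using card_image_le[OF True, of "\<lambda>x. 2 * x"] card_image_le[OF True, of "\<lambda>x. 2 * x + 1"]
    by linarith
next
  case False
  \<comment> \<open>Infinite sets have cardinality 0, so \<open>pairs S\<close> must be shown to be
    infinite too.\<close>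
  have "infinite ((\<lambda>x. 2 * x) ` S)"
    using False finite_imageD[of "\<lambda>x. 2 * x" S] by (auto simp: inj_on_def)
  then have "infinite (pairs S)"
    by (simp add: pairs_eq)
  then show ?thesis
    by simp
qed

lemma selector_xor_pairs:
  assumes S: "selector V f S"
  shows "selector (pairs V) (\<lambda>\<gamma>. f (xor_pairs \<gamma>)) (\<lambda>\<gamma>. pairs (S (xor_pairs \<gamma>)))"
  unfolding selector_def
proof (intro allI conjI impI)
  fix \<alpha> \<beta>
  show "pairs (S (xor_pairs \<alpha>)) \<subseteq> pairs V"
    using selector_subset[OF S] unfolding pairs_def by blast
  assume "\<forall>v\<in>pairs (S (xor_pairs \<alpha>)). \<beta> v = \<alpha> v"
  then have "xor_pairs \<beta> x = xor_pairs \<alpha> x" if "x \<in> S (xor_pairs \<alpha>)" for x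
    using that by (simp add: pairs_eq xor_pairs_def)
  then have "S (xor_pairs \<beta>) = S (xor_pairs \<alpha>)" "f (xor_pairs \<beta>) = f (xor_pairs \<alpha>)"
    using selector_agree[OF S, of "xor_pairs \<alpha>" "xor_pairs \<beta>"] by blast+
  then show "pairs (S (xor_pairs \<beta>)) = pairs (S (xor_pairs \<alpha>))"
    "f (xor_pairs \<beta>) = f (xor_pairs \<alpha>)"
    by simp_all
qed

section \<open>Partial assignments along a refutation\<close>

definition falsifies :: "(nat \<Rightarrow> bool option) \<Rightarrow> nat clause \<Rightarrow> bool" where
  "falsifies \<rho> E \<longleftrightarrow> (\<forall>x. (Pos x \<in> E \<longrightarrow> \<rho> x = Some False) \<and> (Neg x \<in> E \<longrightarrow> \<rho> x = Some True))"

text \<open>Walks from a falsified resolvent to a premise: giving the pivot \<open>x\<close> the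
  value \<open>c\<close> falsifies the remaining literal of one premise. A tautological premise may
  leave a pivot literal in \<open>E\<close>, so a value already given to \<open>x\<close> must not
  be overwritten.\<close>

lemma falsifies_resolvent:
  assumes "resolvent C D E" "falsifies \<rho> E"
  obtains x b where "\<And>c. (\<rho> x = None \<or> \<rho> x = Some c) \<Longrightarrow>
    falsifies (\<rho>(x := Some c)) (if c = b then C else D)"
proof -
  obtain l where l: "l \<in> C" "compl_lit l \<in> D" "E = (C - {l}) \<union> (D - {compl_lit l})"
    using assms(1) by (auto simp: resolvent_def)
  show thesis
  proof (cases l)
    case (Pos x)
    show ?thesis
      using assms(2) l Pos by (intro that[of x False]) (auto simp: falsifies_def)
  next
    case (Neg x)
    show ?thesis
      using assms(2) l Neg by (intro that[of x True]) (auto simp: falsifies_def)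
  qed
qed

definition parity :: "(nat \<Rightarrow> bool option) \<Rightarrow> nat \<Rightarrow> bool option" where
  "parity \<rho> x = (case (\<rho> (2 * x), \<rho> (2 * x + 1)) of (Some a, Some b) \<Rightarrow> Some (a \<noteq> b) | _ \<Rightarrow> None)"

definition override :: "(nat \<Rightarrow> bool option) \<Rightarrow> (nat \<Rightarrow> bool) \<Rightarrow> nat \<Rightarrow> bool" where
  "override \<rho> \<alpha> x = (case \<rho> x of None \<Rightarrow> \<alpha> x | Some b \<Rightarrow> b)"

definition half_set :: "(nat \<Rightarrow> bool option) \<Rightarrow> nat set" where
  "half_set \<rho> = {x. (\<rho> (2 * x) = None) \<noteq> (\<rho> (2 * x + 1) = None)}"

lemma finite_half_set: "finite (dom \<rho>) \<Longrightarrow> finite (half_set \<rho>)"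
proof (rule finite_subset)
  show "half_set \<rho> \<subseteq> (\<lambda>v. v div 2) ` dom \<rho>"
  proof
    fix x assume "x \<in> half_set \<rho>"
    then have "2 * x \<in> dom \<rho> \<or> 2 * x + 1 \<in> dom \<rho>"
      by (auto simp: half_set_def)
    then show "x \<in> (\<lambda>v. v div 2) ` dom \<rho>"
      by (auto intro: image_eqI[of _ _ "2 * x"] image_eqI[of _ _ "2 * x + 1"])
  qed
qed simp

text \<open>Translates an extension of the partial assignment into the update by which
  \<open>hard\<close> records an answer.\<close>

lemma override_upd: "\<rho> x = None \<Longrightarrow> override (\<rho>(x := Some b)) \<alpha> = override \<rho> (\<alpha>(x := b))"
  by (auto simp: override_def fun_eq_iff split: option.splits)

section \<open>Disjoint subtrees of a tree-like refutation\<close>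

definition used_by :: "'v line list \<Rightarrow> (nat \<times> nat) set" where
  "used_by \<pi> = {(k, i). k < length \<pi> \<and> i \<in> set (line_premises (\<pi> ! k))}"

text \<open>Only derived lines are collected: initial lines may have several users, so with them the
  subtrees of two premises could overlap.\<close>

definition subtree :: "'v line list \<Rightarrow> nat \<Rightarrow> nat set" where
  "subtree \<pi> k = {t. (k, t) \<in> (used_by \<pi>)\<^sup>* \<and> is_Derived (\<pi> ! t)}"

lemma count_list_concat:
  "count_list (concat (map h xs)) y = (\<Sum>k<length xs. count_list (h (xs ! k)) y)"
  by (induction xs rule: rev_induct) (simp_all add: nth_append)

lemma tree_like_unique_user:
  assumes "tree_like \<pi>" "(k, t) \<in> used_by \<pi>" "(k', t) \<in> used_by \<pi>" "t < length \<pi>" "is_Derived (\<pi> ! t)"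
  shows "k = k'"
proof (rule ccontr)
  assume "k \<noteq> k'"
  have k: "k < length \<pi>" "k' < length \<pi>" "t \<in> set (line_premises (\<pi> ! k))" "t \<in> set (line_premises (\<pi> ! k'))"
    using assms by (auto simp: used_by_def)
  then have "1 \<le> count_list (line_premises (\<pi> ! k)) t" "1 \<le> count_list (line_premises (\<pi> ! k')) t"
    by (metis One_nat_def Suc_leI count_list_0_iff neq0_conv)+
  then have "2 \<le> (\<Sum>i\<in>{k, k'}. count_list (line_premises (\<pi> ! i)) t)"
    using \<open>k \<noteq> k'\<close> by simp
  also have "\<dots> \<le> (\<Sum>i<length \<pi>. count_list (line_premises (\<pi> ! i)) t)"
    using k by (intro sum_mono2) auto
  also have "\<dots> \<le> 1"
    using assms unfolding tree_like_def by (simp add: count_list_concat)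
  finally show False
    by simp
qed

context
  fixes F :: "'v cnf" and \<pi> :: "'v line list"
  assumes valid: "\<And>k. k < length \<pi> \<Longrightarrow> valid_line F \<pi> k (\<pi> ! k)"
    and tree: "tree_like \<pi>"
begin

lemma used_by_less: "(k, i) \<in> used_by \<pi> \<Longrightarrow> i < k \<and> k < length \<pi> \<and> is_Derived (\<pi> ! k)"
  using valid[of k] by (cases "\<pi> ! k") (auto simp: used_by_def)

lemma rtrancl_used_by_le: "(k, i) \<in> (used_by \<pi>)\<^sup>* \<Longrightarrow> i \<le> k"
  by (induction rule: rtrancl_induct) (auto dest: used_by_less)

lemma subtree_mono: "(k, i) \<in> used_by \<pi> \<Longrightarrow> subtree \<pi> i \<subseteq> subtree \<pi> k"
  unfolding subtree_def by (auto intro: converse_rtrancl_into_rtrancl)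

lemma finite_subtree: "finite (subtree \<pi> k)"
  by (rule finite_subset[of _ "{..k}"]) (auto simp: subtree_def dest: rtrancl_used_by_le)

text \<open>The largest common line \<open>t\<close> has only one user. On both sides the path to
  \<open>t\<close> passes through this user, which would be a larger common line, or else the user
  is \<open>k\<close>, which lies above both premises.\<close>

lemma subtree_disjoint:
  assumes k: "k < length \<pi>" "\<pi> ! k = Derived C i j"
  shows "subtree \<pi> i \<inter> subtree \<pi> j = {}"
proof (rule ccontr)
  assume "subtree \<pi> i \<inter> subtree \<pi> j \<noteq> {}"
  then have fin: "finite (subtree \<pi> i \<inter> subtree \<pi> j)" "subtree \<pi> i \<inter> subtree \<pi> j \<noteq> {}"
    using finite_subtree by auto
  define t where "t = Max (subtree \<pi> i \<inter> subtree \<pi> j)"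
  have t: "(i, t) \<in> (used_by \<pi>)\<^sup>*" "(j, t) \<in> (used_by \<pi>)\<^sup>*" "is_Derived (\<pi> ! t)"
    using Max_in[OF fin] by (auto simp: t_def subtree_def)
  have max: "s \<le> t" if "s \<in> subtree \<pi> i" "s \<in> subtree \<pi> j" for s
    using Max_ge[OF fin(1)] that by (simp add: t_def)
  have ij: "(k, i) \<in> used_by \<pi>" "(k, j) \<in> used_by \<pi>"
    using k by (auto simp: used_by_def)
  have less: "i < k" "j < k"
    using ij used_by_less by blast+
  have tlen: "t < length \<pi>"
    using rtrancl_used_by_le[OF t(1)] less k by simp
  have user: "s = s'" if "(s, t) \<in> used_by \<pi>" "(s', t) \<in> used_by \<pi>" for s s'
    using tree_like_unique_user[OF tree that tlen t(3)] .
  have "i \<noteq> j"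
  \<comment> \<open>Otherwise line \<open>k\<close> would use the same derived line twice, and uses
    are counted with multiplicity.\<close>
  proof
    assume "i = j"
    then have il: "is_Derived (\<pi> ! i)"
      using t less k rtranclE[OF t(1)]
      by (metis converse_rtranclE used_by_less)
    have "2 \<le> count_list (line_premises (\<pi> ! k)) i"
      using k \<open>i = j\<close> by simp
    also have "\<dots> \<le> (\<Sum>n<length \<pi>. count_list (line_premises (\<pi> ! n)) i)"
      using k by (intro member_le_sum) auto
    also have "\<dots> \<le> 1"
      using tree il less k unfolding tree_like_def by (simp add: count_list_concat)
    finally show False
      by simp
  qed
  from t(1) show False
  proof (cases rule: rtranclE)
    case base
    then have "(j, i) \<in> (used_by \<pi>)\<^sup>*"
      using t(2) by simp
    then obtain s where s: "(j, s) \<in> (used_by \<pi>)\<^sup>*" "(s, i) \<in> used_by \<pi>"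
      using \<open>i \<noteq> j\<close> by (metis rtranclE)
    then have "s = k"
      using user ij(1) base by blast
    then show False
      using rtrancl_used_by_le[OF s(1)] less by simp
  next
    case (step s)
    from t(2) show False
    proof (cases rule: rtranclE)
      case base
      then have "s = k"
        using user ij(2) step by blast
      then show False
        using rtrancl_used_by_le[OF step(1)] less by simp
    next
      case (step s')
      then have "s' = s"
        using user \<open>(s, t) \<in> used_by \<pi>\<close> by blast
      then have "s \<in> subtree \<pi> i" "s \<in> subtree \<pi> j"
        using step \<open>(i, s) \<in> (used_by \<pi>)\<^sup>*\<close> used_by_less by (auto simp: subtree_def)
      then show False
        using max used_by_less[OF \<open>(s, t) \<in> used_by \<pi>\<close>] by fastforce
    qed
  qed
qed

lemma card_subtree_Derived:
  assumes k: "k < length \<pi>" "\<pi> ! k = Derived C i j"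
  shows "card (subtree \<pi> i) + card (subtree \<pi> j) + 1 \<le> card (subtree \<pi> k)"
proof -
  have ij: "(k, i) \<in> used_by \<pi>" "(k, j) \<in> used_by \<pi>"
    using k by (auto simp: used_by_def)
  have "k \<notin> subtree \<pi> i \<union> subtree \<pi> j"
    using used_by_less[OF ij(1)] used_by_less[OF ij(2)]
    by (auto simp: subtree_def dest!: rtrancl_used_by_le)
  then have "card (insert k (subtree \<pi> i \<union> subtree \<pi> j)) = card (subtree \<pi> i) + card (subtree \<pi> j) + 1"
    using finite_subtree subtree_disjoint[OF k] by (simp add: card_Un_disjoint)
  moreover have "insert k (subtree \<pi> i \<union> subtree \<pi> j) \<subseteq> subtree \<pi> k"
    using subtree_mono[OF ij(1)] subtree_mono[OF ij(2)] k(2) by (auto simp: subtree_def)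
  ultimately show ?thesis
    using card_mono[OF finite_subtree] by metis
qed

lemma card_subtree_less: "k < length \<pi> \<Longrightarrow> card (subtree \<pi> k) < length \<pi>"
proof -
  assume k: "k < length \<pi>"
  have "\<not> is_Derived (\<pi> ! 0)"
    using valid[OF le_less_trans[OF le0 k]] by (cases "\<pi> ! 0") auto
  then have "subtree \<pi> k \<subseteq> {1..k}"
    using rtrancl_used_by_le by (force simp: subtree_def Suc_le_eq intro: gr0I)
  from card_mono[OF _ this] show ?thesis
    using k by simp
qed

end

text \<open>The first query to a pair can be answered both ways, which doubles the size; only the
  second one costs the adversary a query to \<open>f\<close>. The potential charges half-fixed pairs for the
  doubling already used.\<close>

lemma subtree_size:
  fixes f :: "(nat \<Rightarrow> bool) \<Rightarrow> bool"
  assumes S: "selector V f S"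
    and valid: "\<And>k. k < length \<pi> \<Longrightarrow>
      valid_line (selector_cnf (\<lambda>\<gamma>. pairs (S (xor_pairs \<gamma>)))) \<pi> k (\<pi> ! k)"
    and tree: "tree_like \<pi>"
    and "k < length \<pi>" "falsifies \<rho> (line_clause (\<pi> ! k))" "finite (dom \<rho>)"
    and "hard UNIV d (\<lambda>\<alpha>. f (override (parity \<rho>) \<alpha>))"
  shows "2 ^ (d - card (half_set \<rho>)) \<le> card (subtree \<pi> k) + 1"
  using assms(4-)
proof (induction k arbitrary: \<rho> d rule: less_induct)
  case (less k)
  note prems = less.prems and IH = less.IH
  show ?case
  proof (cases "\<pi> ! k")
    case (Initial C)
    then have "C \<in> selector_cnf (\<lambda>\<gamma>. pairs (S (xor_pairs \<gamma>)))"
      using valid[OF prems(1)] by simp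
    then obtain \<gamma> where C: "C = falsified_clause \<gamma> (pairs (S (xor_pairs \<gamma>)))"
      by (auto simp: selector_cnf_def)
    have \<rho>: "\<rho> v = Some (\<gamma> v)" if "v \<in> pairs (S (xor_pairs \<gamma>))" for v
    proof -
      have "(if \<gamma> v then Neg v else Pos v) \<in> C"
        unfolding C falsified_clause_def using that by blast
      then show ?thesis
        using prems(2) Initial by (auto simp: falsifies_def split: if_splits)
    qed
    have "override (parity \<rho>) \<alpha> x = xor_pairs \<gamma> x" if "x \<in> S (xor_pairs \<gamma>)" for \<alpha> x
    proof -
      have "\<rho> (2 * x) = Some (\<gamma> (2 * x))" "\<rho> (2 * x + 1) = Some (\<gamma> (2 * x + 1))"
        using that by (auto intro!: \<rho> simp: pairs_def)
      then show ?thesis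
        by (simp add: override_def parity_def xor_pairs_def)
    qed
    then have const: "f (override (parity \<rho>) \<alpha>) = f (xor_pairs \<gamma>)" for \<alpha>
      by (intro selector_agree(2)[OF S])
    \<comment> \<open>A falsified initial clause fixes all selected pairs, so \<open>f\<close> is
      constant under \<open>\<rho>\<close> and no budget can be left.\<close>
    have "d = 0"
    proof (cases d)
      case (Suc d')
      from hard_Suc_attains[OF prems(4)[unfolded Suc], of "\<not> f (xor_pairs \<gamma>)"] show ?thesis
        using const by auto
    qed
    then show ?thesis
      by simp
  next
    case (Derived E i j)
    have E: "falsifies \<rho> E" and ij: "i < k" "j < k"
      and res: "resolvent (line_clause (\<pi> ! i)) (line_clause (\<pi> ! j)) E"
      using prems(2) valid[OF prems(1)] Derived by auto
    have len: "i < length \<pi>" "j < length \<pi>"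
      using ij prems(1) by auto
    note size = card_subtree_Derived[OF valid tree prems(1) Derived, simplified]
    obtain v b0 where step: "\<And>c. (\<rho> v = None \<or> \<rho> v = Some c) \<Longrightarrow>
        falsifies (\<rho>(v := Some c)) (if c = b0 then line_clause (\<pi> ! i) else line_clause (\<pi> ! j))"
      by (rule falsifies_resolvent[OF res E], rule that)
    \<comment> \<open>The premise to visit when the pivot is given the value
      \<open>c\<close>.\<close>
    define prem where "prem c = (if c = b0 then i else j)" for c
    have fals: "falsifies (\<rho>(v := Some c)) (line_clause (\<pi> ! prem c))"
      if "\<rho> v = None \<or> \<rho> v = Some c" for c
      using step[OF that] by (simp add: prem_def split: if_splits)
    have prem: "prem c < k" "prem c < length \<pi>" for c
      using ij len by (auto simp: prem_def)
    have le: "card (subtree \<pi> (prem c)) \<le> card (subtree \<pi> k)" for c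
      using size by (auto simp: prem_def)
    have both: "card (subtree \<pi> (prem True)) + card (subtree \<pi> (prem False)) + 1 \<le> card (subtree \<pi> k)"
      using size by (cases b0) (auto simp: prem_def)
    define x where "x = v div 2"
    have v: "v = 2 * x \<or> v = 2 * x + 1"
      unfolding x_def by presburger
    define v' where "v' = (if v = 2 * x then 2 * x + 1 else 2 * x)"
    have odd_even: "Suc (2 * y) \<noteq> 2 * z" "2 * z \<noteq> Suc (2 * y)" for y z :: nat
      by presburger+
    have fin: "finite (dom (\<rho>(v := Some c)))" for c
      using prems(3) by simp
    show ?thesis
    proof (cases "\<rho> v")
      \<comment> \<open>The pivot is already set, so the walk follows the premise falsified under
        its value, and nothing else changes.\<close>
      case (Some c)
      then have "\<rho>(v := Some c) = \<rho>"
        by auto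
      then have "2 ^ (d - card (half_set \<rho>)) \<le> card (subtree \<pi> (prem c)) + 1"
        using IH[OF prem(1) prem(2), of \<rho> c d] fals[of c] prems Some by simp
      then show ?thesis
        using le[of c] by simp
    next
      case None
      show ?thesis
      proof (cases "\<rho> v'")
        case v': None
        have half: "card (half_set (\<rho>(v := Some c))) \<le> card (half_set \<rho>) + 1" for c
        proof -
          have "half_set (\<rho>(v := Some c)) \<subseteq> insert x (half_set \<rho>)"
            using v by (auto simp: half_set_def)
          then have "card (half_set (\<rho>(v := Some c))) \<le> card (insert x (half_set \<rho>))"
            using finite_half_set[OF prems(3)] by (intro card_mono) auto
          also have "\<dots> \<le> card (half_set \<rho>) + 1"
            using finite_half_set[OF prems(3)] by (simp add: card_insert_if)
          finally show ?thesis .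
        qed
        \<comment> \<open>The partner \<open>v'\<close> of the pivot is unset, so either value
          leaves all parities open or unchanged, and both premises can be visited.\<close>
        have par: "parity (\<rho>(v := Some c)) = parity \<rho>" for c
          using v v' None by (auto simp: parity_def v'_def odd_even fun_eq_iff split: option.splits if_splits)
        have sz: "2 ^ (d - (card (half_set \<rho>) + 1)) \<le> card (subtree \<pi> (prem c)) + 1" for c
        proof -
          have "2 ^ (d - card (half_set (\<rho>(v := Some c)))) \<le> card (subtree \<pi> (prem c)) + 1"
            using prems(4) None unfolding par[of c, symmetric]
            by (intro IH[OF prem(1) prem(2) fals fin]) blast+
          moreover have "(2::nat) ^ (d - (card (half_set \<rho>) + 1)) \<le> 2 ^ (d - card (half_set (\<rho>(v := Some c))))"
            using half[of c] by (intro power_increasing) auto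
          ultimately show ?thesis
            by linarith
        qed
        \<comment> \<open>Truncated subtraction does no harm: this also holds when the exponent is
          already 0. Below, line \<open>k\<close> itself makes up for one of the two terms
          \<open>+ 1\<close> of the premises.\<close>
        have "(2::nat) ^ (d - card (half_set \<rho>)) \<le> 2 * 2 ^ (d - (card (half_set \<rho>) + 1))"
          by (simp flip: power_Suc add: power_increasing)
        then show ?thesis
          using sz[of True] sz[of False] both by linarith
      next
        case v': (Some a)
        show ?thesis
        proof (cases d)
          case (Suc d')
          obtain b where b: "hard UNIV d' (\<lambda>\<alpha>. f (override (parity \<rho>) (\<alpha>(x := b))))"
            using prems(4) unfolding Suc by auto
          \<comment> \<open>The value that makes the parity of the pair equal to the adversary's
            answer \<open>b\<close>.\<close>
          define c where "c = (a \<noteq> b)"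
          have px: "parity \<rho> x = None"
            using v None by (auto simp: parity_def split: option.splits)
          have "parity (\<rho>(v := Some c)) = (parity \<rho>)(x := Some b)"
            using v v' None by (auto simp: parity_def v'_def c_def odd_even fun_eq_iff split: option.splits if_splits)
          then have "hard UNIV d' (\<lambda>\<alpha>. f (override (parity (\<rho>(v := Some c))) \<alpha>))"
            using b px by (simp add: override_upd)
          then have sz: "2 ^ (d' - card (half_set (\<rho>(v := Some c)))) \<le> card (subtree \<pi> (prem c)) + 1"
            using None by (intro IH[OF prem(1) prem(2) fals fin]) blast+
          have "half_set \<rho> = insert x (half_set (\<rho>(v := Some c)))" "x \<notin> half_set (\<rho>(v := Some c))"
            using v v' None by (auto simp: half_set_def v'_def odd_even split: if_splits)
          moreover have "finite (half_set (\<rho>(v := Some c)))"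
            by (rule finite_half_set[OF fin])
          \<comment> \<open>The budget and the number of half-fixed pairs both drop by one, so the
            exponent is unchanged.\<close>
          ultimately have "card (half_set \<rho>) = card (half_set (\<rho>(v := Some c))) + 1"
            by simp
          then have "d' - card (half_set (\<rho>(v := Some c))) = d - card (half_set \<rho>)"
            using Suc by simp
          then show ?thesis
            using sz le[of c] by simp
        qed simp
      qed
    qed
  qed
qed

text \<open>The walk starts at the empty clause with nothing assigned, where \<open>override\<close>
  is the identity and no pair is half-fixed.\<close>

lemma refutation_size_selector_cnf:
  fixes f :: "(nat \<Rightarrow> bool) \<Rightarrow> bool"
  assumes S: "selector V f S" and d: "hard UNIV d f"
    and \<pi>: "resolution_refutation (selector_cnf (\<lambda>\<gamma>. pairs (S (xor_pairs \<gamma>)))) \<pi>" "tree_like \<pi>"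
  shows "2 ^ d \<le> refutation_size \<pi>"
proof -
  have valid: "valid_line (selector_cnf (\<lambda>\<gamma>. pairs (S (xor_pairs \<gamma>)))) \<pi> k (\<pi> ! k)"
    if "k < length \<pi>" for k
    using \<pi>(1) that by (simp add: resolution_refutation_def)
  let ?k = "length \<pi> - 1"
  have k: "?k < length \<pi>" "line_clause (\<pi> ! ?k) = {}"
    using \<pi>(1) by (auto simp: resolution_refutation_def last_conv_nth)
  have "override (parity (\<lambda>_. None)) = id"
    by (auto simp: override_def parity_def fun_eq_iff)
  then have "2 ^ (d - card (half_set (\<lambda>_. None))) \<le> card (subtree \<pi> ?k) + 1"
    using d k by (intro subtree_size[OF S valid \<pi>(2)]) (auto simp: falsifies_def)
  then show ?thesis
    using card_subtree_less[OF valid \<pi>(2) k(1)] by (simp add: half_set_def refutation_size_def)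
qed

section \<open>Iterating cheat sheets and or-and composition\<close>

lemma card_bool_lists: "card {xs :: bool list. length xs = c} = 2 ^ c"
  using card_lists_length_eq[of "UNIV :: bool set" c] by simp

text \<open>One round of the iteration: \<open>c\<close> copies of \<open>f\<close> form the
  address, the cheat sheet makes true values cheap, and or-and composition gains n^2 in hardness but
  only \<open>n\<close>, up to constants and powers of \<open>p\<close>, in the other two measures.
  \<open>B\<close> sums the coefficients in the bounds on \<open>M\<close> and
  \<open>2 * k\<close>.\<close>

lemma cheat_sheet_step:
  fixes f :: "(nat \<Rightarrow> bool) \<Rightarrow> bool" and j K p :: nat
  defines "n \<equiv> 2 ^ p" and "B \<equiv> 2 * j * K * (2 * j + K) + 1 + 2 * (2 * j * K)"
  assumes V: "finite V" "card V \<le> 2 ^ (K * p)" and p: "1 \<le> p"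
    and certs: "has_certs V f (K * p ^ K * n ^ j)"
    and S: "selector V f S" "\<And>\<alpha>. card (S \<alpha>) \<le> K * p ^ K * n ^ (j + 1)"
    and hard: "hard UNIV (n ^ (2 * j)) f"
  obtains V' and f' :: "(nat \<Rightarrow> bool) \<Rightarrow> bool" and S' where "finite V'" "card V' \<le> 2 ^ ((3 * j + B + K + 5) * p)"
    "has_certs V' f' (B * p ^ (K + 2) * n ^ (j + 1))" "selector V' f' S'"
    "\<And>\<alpha>. card (S' \<alpha>) \<le> B * p ^ (K + 2) * n ^ (j + 2)" "hard UNIV (n ^ (2 * (j + 1))) f'"
proof -
  \<comment> \<open>With \<open>c\<close> bits there are \<open>2 ^ c = n ^ (2 * j)\<close>
    addresses, just as many as the hardness of \<open>f\<close>.\<close>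
  define c where "c = 2 * j * p"
  define A where "A = {xs :: bool list. length xs = c}"
  define k where "k = c * (K * p ^ K * n ^ j)"
  define u where "u = c * (K * p ^ K * n ^ (j + 1))"
  \<comment> \<open>There are at most \<open>2 ^ ((2 * j + K) * p * k)\<close> sets of at most
    \<open>k\<close> variables of the copies; one more bit makes room for
    \<open>None\<close>.\<close>
  define M where "M = (2 * j + K) * p * k + 1"
  \<comment> \<open>The common scale: \<open>k\<close> carries \<open>p ^ (K + 1)\<close> because of
    the copies, and \<open>M\<close> one factor \<open>p\<close> more.\<close>
  define q where "q = p ^ (K + 2) * n ^ j"
  have n: "0 < n"
    by (simp add: n_def)
  have cardA: "card A = 2 ^ c" "finite A"
    unfolding A_def by (simp_all add: card_bool_lists card_ge_0_finite)
  have nc: "n ^ (2 * j) = 2 ^ c"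
    by (simp add: n_def c_def mult.commute flip: power_mult)
  have cardW: "card (blocks c V) \<le> c * 2 ^ (K * p)"
    using card_blocks[of c V] V(2) by (meson le_trans mult_le_mono2)
  have Suc_c: "c + 1 \<le> 2 ^ c"
    using Suc_leI[OF less_exp[of c]] by linarith
  have "card (blocks c V) + 1 \<le> (c + 1) * 2 ^ (K * p)"
    using cardW one_le_power[of "2 :: nat" "K * p"] unfolding add_mult_distrib by linarith
  also have "\<dots> \<le> 2 ^ c * 2 ^ (K * p)"
    using Suc_c by (rule mult_le_mono1)
  also have "\<dots> = 2 ^ ((2 * j + K) * p)"
    by (simp add: c_def algebra_simps flip: power_add)
  finally have "(card (blocks c V) + 1) ^ k \<le> (2 ^ ((2 * j + K) * p)) ^ k"
    by (rule power_mono) simp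
  then have "(card (blocks c V) + 1) ^ k + 1 \<le> 2 ^ ((2 * j + K) * p * k) + 2 ^ ((2 * j + K) * p * k)"
    by (intro add_mono) (simp_all flip: power_mult)
  then have M: "(card (blocks c V) + 1) ^ k + 1 \<le> 2 ^ M"
    by (simp add: M_def)
  have sel_card: "card (\<Union>i<c. shift i (S (block i \<alpha>))) \<le> u" for \<alpha>
    unfolding u_def
    using card_UN_shift_le[of "{..<c}" "\<lambda>i. S (block i \<alpha>)" "K * p ^ K * n ^ (j + 1)" "\<lambda>i. i"] S(2)
    by simp
  have rng: "range (tuple c f) \<subseteq> A"
    by (auto simp: A_def tuple_def)
  have crt: "has_certs (blocks c V) (tuple c f) k"
    unfolding k_def by (rule has_certs_tuple[OF certs])
  have hrd: "hard A (n ^ (2 * j)) (tuple c f)" "n ^ (2 * j) \<le> card A"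
    unfolding A_def using hard_tuple[OF hard] nc by (simp_all add: card_bool_lists)
  obtain V1 f1 S1 where 1: "finite V1" "card V1 \<le> card (blocks c V) + card A * M"
    "hard UNIV (n ^ (2 * j)) f1" "has_certs V1 f1 (M + 2 * k)" "selector V1 f1 S1"
    "\<And>\<alpha>. card (S1 \<alpha>) \<le> M + k + (if f1 \<alpha> then 0 else u)"
    by (rule cheat_sheet_exists[OF finite_blocks[OF V(1)] cardA(2) rng M crt
          selector_tuple[OF S(1)] sel_card hrd], rule that)
  obtain S2 where 2: "selector (blocks n (blocks n V1)) (or_and n f1) S2"
    "\<And>\<alpha>. card (S2 \<alpha>) \<le> n * (n * (M + k) + u)"
    by (rule selector_or_and[OF 1(5,6)], rule that)
  have ppow: "p ^ e \<le> p ^ (K + 2)" if "e \<le> K + 2" for e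
    using that p by (intro power_increasing) auto
  have "k = 2 * j * K * (p ^ (K + 1) * n ^ j)"
    by (simp add: k_def c_def)
  also have "\<dots> \<le> 2 * j * K * q"
    unfolding q_def using ppow[of "K + 1"] by (intro mult_le_mono) auto
  finally have k: "k \<le> 2 * j * K * q" .
  have q: "1 \<le> q"
    unfolding q_def using p n by (simp add: Suc_le_eq)
  have "M = 2 * j * K * (2 * j + K) * q + 1"
    by (simp add: M_def k_def c_def q_def)
  also have "\<dots> \<le> (2 * j * K * (2 * j + K) + 1) * q"
    using q by simp
  finally have M_le: "M \<le> (2 * j * K * (2 * j + K) + 1) * q" .
  \<comment> \<open>The long part \<open>u\<close> exceeds \<open>k\<close> by a factor
    \<open>n\<close>, but a disjunct pays it once and the short part \<open>n\<close> times, so both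
    fit the same bound.\<close>
  have "u = k * n"
    by (simp add: u_def k_def)
  then have u: "u \<le> 2 * j * K * q * n"
    using k by simp
  have M2k: "M + 2 * k \<le> B * q"
    using k M_le unfolding B_def add_mult_distrib by linarith
  show thesis
  proof
    show "finite (blocks n (blocks n V1))"
      using 1(1) by (intro finite_blocks)
    show "hard UNIV (n ^ (2 * (j + 1))) (or_and n f1)"
      using hard_or_and[OF 1(3), of n] n by (simp add: power2_eq_square mult.assoc)
    have "has_certs (blocks n (blocks n V1)) (or_and n f1) (n * (M + 2 * k))"
      by (rule has_certs_or_and[OF 1(4)])
    moreover have "n * (M + 2 * k) \<le> B * p ^ (K + 2) * n ^ (j + 1)"
      using mult_le_mono2[OF M2k, of n] by (simp add: q_def mult_ac)
    ultimately show "has_certs (blocks n (blocks n V1)) (or_and n f1) (B * p ^ (K + 2) * n ^ (j + 1))"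
      unfolding has_certs_def by (meson le_trans)
    show "selector (blocks n (blocks n V1)) (or_and n f1) S2"
      by (rule 2(1))
    show "card (S2 \<alpha>) \<le> B * p ^ (K + 2) * n ^ (j + 2)" for \<alpha>
    proof -
      have "n * (M + k) + u \<le> n * ((2 * j * K * (2 * j + K) + 1) * q + 2 * j * K * q) + 2 * j * K * q * n"
        using k M_le u by (intro add_mono mult_le_mono2) auto
      also have "\<dots> = n * (B * q)"
        by (simp add: B_def algebra_simps)
      finally have "n * (n * (M + k) + u) \<le> n * (n * (B * q))"
        by simp
      also have "\<dots> = B * p ^ (K + 2) * n ^ (j + 2)"
        by (simp add: q_def mult_ac)
      finally show ?thesis
        by (rule order_trans[OF 2(2)])
    qed
    show "card (blocks n (blocks n V1)) \<le> 2 ^ ((3 * j + B + K + 5) * p)"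
    proof -
      \<comment> \<open>As \<open>n\<close> is \<open>2 ^ p\<close>, every factor is bounded by a
        fixed power of \<open>2 ^ p\<close>.\<close>
      have pexp: "p ^ e \<le> 2 ^ (e * p)" for e
        using power_mono[OF less_imp_le[OF less_exp[of p]], of e]
        by (simp add: mult.commute flip: power_mult)
      have "B \<le> 2 ^ B"
        using less_exp[of B] by simp
      also have "\<dots> \<le> 2 ^ (B * p)"
        using p by (intro power_increasing) auto
      finally have B: "B \<le> 2 ^ (B * p)" .
      have "M \<le> B * q"
        using M2k by simp
      also have "\<dots> \<le> 2 ^ (B * p) * (2 ^ ((K + 2) * p) * 2 ^ (j * p))"
        unfolding q_def using B pexp[of "K + 2"]
        by (intro mult_le_mono) (auto simp only: n_def mult.commute[of j] power_mult order_refl)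
      also have "\<dots> = 2 ^ ((B + K + 2 + j) * p)"
        by (simp add: add_mult_distrib power_add)
      finally have Mp: "M \<le> 2 ^ ((B + K + 2 + j) * p)" .
      have "card V1 \<le> c * 2 ^ (K * p) + 2 ^ c * M"
        using 1(2) cardW cardA(1) by simp
      also have "\<dots> \<le> 2 ^ c * 2 ^ (K * p) + 2 ^ c * 2 ^ ((B + K + 2 + j) * p)"
        using Suc_c Mp by (intro add_mono mult_le_mono) auto
      also have "\<dots> \<le> 2 ^ c * 2 ^ ((B + K + 2 + j) * p) + 2 ^ c * 2 ^ ((B + K + 2 + j) * p)"
        by (intro add_mono mult_le_mono2 power_increasing mult_le_mono1) auto
      also have "\<dots> = 2 ^ (1 + c + (B + K + 2 + j) * p)"
        by (simp add: power_add)
      also have "\<dots> \<le> 2 ^ ((3 * j + B + K + 3) * p)"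
        using p by (intro power_increasing) (auto simp: c_def algebra_simps)
      finally have V1: "card V1 \<le> 2 ^ ((3 * j + B + K + 3) * p)" .
      have "card (blocks n (blocks n V1)) \<le> n * (n * card V1)"
        using card_blocks[of n "blocks n V1"] card_blocks[of n V1] by (meson le_trans mult_le_mono2)
      also have "\<dots> \<le> n * (n * 2 ^ ((3 * j + B + K + 3) * p))"
        using V1 by simp
      also have "\<dots> = 2 ^ ((3 * j + B + K + 5) * p)"
        unfolding n_def power_add[symmetric] by (simp add: algebra_simps)
      finally show ?thesis .
    qed
  qed
qed

text \<open>The induction starts from a single variable. \<open>K\<close> depends on
  \<open>j\<close> but not on \<open>p\<close>, so for fixed \<open>j\<close> the factor
  \<open>p ^ K\<close> is a power of the logarithm of \<open>2 ^ p\<close>.\<close>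

lemma iterated_cheat_sheets:
  "\<exists>K. \<forall>p\<ge>1. \<exists>V (f :: (nat \<Rightarrow> bool) \<Rightarrow> bool) S. finite V \<and> card V \<le> 2 ^ (K * p)
     \<and> has_certs V f (K * p ^ K * (2 ^ p) ^ j) \<and> selector V f S
     \<and> (\<forall>\<alpha>. card (S \<alpha>) \<le> K * p ^ K * (2 ^ p) ^ (j + 1)) \<and> hard UNIV ((2 ^ p) ^ (2 * j)) f"
proof (induction j)
  case 0
  show ?case
  proof (intro exI[of _ 1] allI impI)
    fix p :: nat assume p: "1 \<le> p"
    have "UNIV \<subseteq> range (\<lambda>\<alpha>. \<alpha> (0::nat) :: bool)"
    proof
      show "b \<in> range (\<lambda>\<alpha>. \<alpha> (0::nat))" for b :: bool
        by (rule image_eqI[of _ _ "\<lambda>_. b"]) auto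
    qed
    then have "hard UNIV 1 (\<lambda>\<alpha>. \<alpha> 0 :: bool)"
      by simp
    moreover have "selector {0} (\<lambda>\<alpha>. \<alpha> 0) (\<lambda>_. {0})"
      by (simp add: selector_def)
    moreover have "has_certs {0} (\<lambda>\<alpha>. \<alpha> 0 :: bool) (1 * p ^ 1 * (2 ^ p) ^ 0)"
      unfolding has_certs_def using p by (auto simp: certifies_def intro!: exI[of _ "{0}"])
    moreover have "1 \<le> p * 2 ^ p"
      using p by (simp add: Suc_le_eq)
    ultimately show "\<exists>V (f :: (nat \<Rightarrow> bool) \<Rightarrow> bool) S. finite V \<and> card V \<le> 2 ^ (1 * p)
       \<and> has_certs V f (1 * p ^ 1 * (2 ^ p) ^ 0) \<and> selector V f S
       \<and> (\<forall>\<alpha>. card (S \<alpha>) \<le> 1 * p ^ 1 * (2 ^ p) ^ (0 + 1)) \<and> hard UNIV ((2 ^ p) ^ (2 * 0)) f"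
      by (intro exI[of _ "{0}"] exI[of _ "\<lambda>\<alpha>. \<alpha> 0"] exI[of _ "\<lambda>_. {0}"]) auto
  qed
next
  case (Suc j)
  then obtain K where K: "\<And>p. 1 \<le> p \<Longrightarrow> \<exists>V (f :: (nat \<Rightarrow> bool) \<Rightarrow> bool) S. finite V
     \<and> card V \<le> 2 ^ (K * p) \<and> has_certs V f (K * p ^ K * (2 ^ p) ^ j) \<and> selector V f S
     \<and> (\<forall>\<alpha>. card (S \<alpha>) \<le> K * p ^ K * (2 ^ p) ^ (j + 1)) \<and> hard UNIV ((2 ^ p) ^ (2 * j)) f"
    by blast
  define B where "B = 2 * j * K * (2 * j + K) + 1 + 2 * (2 * j * K)"
  define K' where "K' = 3 * j + B + K + 5"
  show ?case
  proof (intro exI[of _ K'] allI impI)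
    fix p :: nat assume p: "1 \<le> p"
    have le: "B * p ^ (K + 2) * (2 ^ p) ^ e \<le> K' * p ^ K' * (2 ^ p) ^ e" for e
      using p by (intro mult_le_mono power_increasing) (auto simp: K'_def)
    obtain V f S where *: "finite V" "card V \<le> 2 ^ (K * p)"
      "has_certs V f (K * p ^ K * (2 ^ p) ^ j)" "selector V f S"
      "\<And>\<alpha>. card (S \<alpha>) \<le> K * p ^ K * (2 ^ p) ^ (j + 1)"
      "hard UNIV ((2 ^ p) ^ (2 * j)) (f :: (nat \<Rightarrow> bool) \<Rightarrow> bool)"
      using K[OF p] by blast
    obtain V' f' S' where **: "finite V'" "card V' \<le> 2 ^ (K' * p)"
      "has_certs V' f' (B * p ^ (K + 2) * (2 ^ p) ^ (j + 1))" "selector V' f' S'"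
      "\<And>\<alpha>. card (S' \<alpha>) \<le> B * p ^ (K + 2) * (2 ^ p) ^ (j + 2)"
      "hard UNIV ((2 ^ p) ^ (2 * (j + 1))) (f' :: (nat \<Rightarrow> bool) \<Rightarrow> bool)"
      by (rule cheat_sheet_step[OF *(1,2) p *(3,4,5,6), folded B_def, folded K'_def], rule that)
    have "has_certs V' f' (K' * p ^ K' * (2 ^ p) ^ Suc j)"
      using **(3) le[of "Suc j"] unfolding has_certs_def by (metis Suc_eq_plus1 le_trans)
    moreover have "card (S' \<alpha>) \<le> K' * p ^ K' * (2 ^ p) ^ (Suc j + 1)" for \<alpha>
      using order_trans[OF **(5)[of \<alpha>] le[of "j + 2"]] by simp
    ultimately show "\<exists>V (f :: (nat \<Rightarrow> bool) \<Rightarrow> bool) S. finite V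
       \<and> card V \<le> 2 ^ (K' * p) \<and> has_certs V f (K' * p ^ K' * (2 ^ p) ^ Suc j) \<and> selector V f S
       \<and> (\<forall>\<alpha>. card (S \<alpha>) \<le> K' * p ^ K' * (2 ^ p) ^ (Suc j + 1))
       \<and> hard UNIV ((2 ^ p) ^ (2 * Suc j)) f"
      using **(1,2,4,6) by (intro exI[of _ V'] exI[of _ f'] exI[of _ S']) simp
  qed
qed

text \<open>Clauses are counted as sets of boundedly many literals; hence the exponent is the width
  times a factor linear in \<open>p\<close>.\<close>

lemma hitting_formulas_exist:
  "\<exists>K. \<forall>p\<ge>1. \<exists>G :: nat cnf. hitting_formula G \<and> unsatisfiable G
     \<and> (\<forall>C\<in>G. width C \<le> 2 * (K * p ^ K * (2 ^ p) ^ (k + 1)))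
     \<and> card G \<le> 2 ^ ((K * p + 3) * (2 * (K * p ^ K * (2 ^ p) ^ (k + 1))))
     \<and> (\<forall>\<pi>. resolution_refutation G \<pi> \<and> tree_like \<pi> \<longrightarrow> 2 ^ (2 ^ p) ^ (2 * k) \<le> refutation_size \<pi>)"
proof -
  obtain K where K: "\<And>p. 1 \<le> p \<Longrightarrow> \<exists>V (f :: (nat \<Rightarrow> bool) \<Rightarrow> bool) S. finite V
     \<and> card V \<le> 2 ^ (K * p) \<and> has_certs V f (K * p ^ K * (2 ^ p) ^ k) \<and> selector V f S
     \<and> (\<forall>\<alpha>. card (S \<alpha>) \<le> K * p ^ K * (2 ^ p) ^ (k + 1)) \<and> hard UNIV ((2 ^ p) ^ (2 * k)) f"
    using iterated_cheat_sheets[of k] by blast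
  show ?thesis
  proof (intro exI[of _ K] allI impI)
    fix p :: nat assume "1 \<le> p"
    then obtain V f S where *: "finite V" "card V \<le> 2 ^ (K * p)" "selector V f S"
      "\<And>\<alpha>. card (S \<alpha>) \<le> K * p ^ K * (2 ^ p) ^ (k + 1)"
      "hard UNIV ((2 ^ p) ^ (2 * k)) (f :: (nat \<Rightarrow> bool) \<Rightarrow> bool)"
      using K by blast
    define w where "w = 2 * (K * p ^ K * (2 ^ p) ^ (k + 1))"
    define G where "G = selector_cnf (\<lambda>\<gamma>. pairs (S (xor_pairs \<gamma>)))"
    define X where "X = Pos ` pairs V \<union> Neg ` pairs V"
    note sel = selector_xor_pairs[OF *(3)]
    have width: "card C \<le> w" if C: "C \<in> G" for C
    proof -
      obtain \<gamma> where "C = falsified_clause \<gamma> (pairs (S (xor_pairs \<gamma>)))"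
        using C unfolding G_def selector_cnf_def by blast
      then show ?thesis
        using card_pairs[of "S (xor_pairs \<gamma>)"] *(4)[of "xor_pairs \<gamma>"]
        by (simp add: card_falsified_clause w_def)
    qed
    have fin: "finite X"
      unfolding X_def using finite_pairs[OF *(1)] by simp
    have "G \<subseteq> {C. C \<subseteq> X \<and> card C \<le> w}"
      using selector_cnf_subset[OF sel] width unfolding G_def X_def by blast
    then have "card G \<le> card {C. C \<subseteq> X \<and> card C \<le> w}"
      using fin by (intro card_mono) auto
    also have "\<dots> \<le> (card X + 1) ^ w"
      by (rule card_bounded_subsets[OF fin])
    also have "\<dots> \<le> (2 ^ (K * p + 3)) ^ w"
    proof (rule power_mono)
      have "card X \<le> card (Pos ` pairs V) + card (Neg ` pairs V)"
        unfolding X_def by (rule card_Un_le)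
      also have "\<dots> \<le> card (pairs V) + card (pairs V)"
        using finite_pairs[OF *(1)] by (intro add_mono card_image_le)
      also have "\<dots> \<le> 4 * 2 ^ (K * p)"
        using card_pairs[of V] *(2) by linarith
      \<comment> \<open>Each variable of \<open>f\<close> yields four literals, and doubling absorbs
        the \<open>+ 1\<close>; this gives the factor 8 behind \<open>K * p + 3\<close>.\<close>
      finally have "card X + 1 \<le> 4 * 2 ^ (K * p) + 4 * 2 ^ (K * p)"
        by (rule add_mono) simp
      then show "card X + 1 \<le> 2 ^ (K * p + 3)"
        by (simp add: power_add)
    qed simp
    finally have "card G \<le> 2 ^ ((K * p + 3) * w)"
      by (simp add: power_mult)
    moreover have "hitting_formula G"
      unfolding G_def by (rule hitting_selector_cnf[OF finite_pairs[OF *(1)] sel])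
    moreover have "unsatisfiable G"
      unfolding G_def by (rule unsatisfiable_selector_cnf)
    moreover have "2 ^ (2 ^ p) ^ (2 * k) \<le> refutation_size \<pi>"
      if "resolution_refutation G \<pi>" "tree_like \<pi>" for \<pi>
      using refutation_size_selector_cnf[OF *(3,5)] that unfolding G_def by blast
    ultimately show "\<exists>G :: nat cnf. hitting_formula G \<and> unsatisfiable G
       \<and> (\<forall>C\<in>G. width C \<le> 2 * (K * p ^ K * (2 ^ p) ^ (k + 1)))
       \<and> card G \<le> 2 ^ ((K * p + 3) * (2 * (K * p ^ K * (2 ^ p) ^ (k + 1))))
       \<and> (\<forall>\<pi>. resolution_refutation G \<pi> \<and> tree_like \<pi> \<longrightarrow> 2 ^ (2 ^ p) ^ (2 * k) \<le> refutation_size \<pi>)"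
      using width unfolding w_def width_def by blast
  qed
qed

section \<open>Choice of parameters and asymptotics\<close>

lemma soft_O_realI:
  assumes "\<And>m. N \<le> m \<Longrightarrow> \<bar>g m\<bar> \<le> c * (real m * ln (real m) ^ E)"
  shows "g \<in> soft_O real"
proof -
  have "eventually (\<lambda>m. norm (g m) \<le> c * norm (real m * ln (real m) ^ E)) at_top"
  proof (rule eventually_mono[OF eventually_ge_at_top[of "max N 1"]])
    fix m assume "max N 1 \<le> m"
    then show "norm (g m) \<le> c * norm (real m * ln (real m) ^ E)"
      using assms[of m] by (simp add: abs_mult)
  qed
  then have "g \<in> O(\<lambda>m. real m * ln (real m) ^ E)"
    by (rule bigoI)
  then show ?thesis
    by (auto simp: soft_O_def)
qed

theorem theorem3p15:
  fixes \<epsilon> :: real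
  assumes "\<epsilon> > 0"
  shows "\<exists>G :: nat \<Rightarrow> nat cnf.
    (\<forall>m. hitting_formula (G m) \<and> unsatisfiable (G m)) \<and>
    (\<exists>a \<in> soft_O (\<lambda>m. real m). \<forall>m. real (card (G m)) = 2 powr a m) \<and>
    (\<exists>w \<in> soft_O (\<lambda>m. real m). \<forall>m. \<forall>C \<in> G m. real (width C) \<le> w m) \<and>
    (\<exists>s \<in> soft_Omega (\<lambda>m. real m powr (2 - \<epsilon>)).
       \<forall>m \<pi>. resolution_refutation (G m) \<pi> \<and> tree_like \<pi> \<longrightarrow>
              real (refutation_size \<pi>) \<ge> 2 powr s m)"
proof -
  \<comment> \<open>This makes 2k/(k+1) at least 2 - \<epsilon>, the ratio of the hardness exponent
    \<open>2 * k\<close> to the width exponent \<open>k + 1\<close>.\<close>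
  obtain k :: nat where k: "2 / \<epsilon> \<le> real k"
    using real_arch_simple by blast
  from hitting_formulas_exist[of k] obtain K where K: "\<forall>p\<ge>1. \<exists>G :: nat cnf. hitting_formula G
     \<and> unsatisfiable G \<and> (\<forall>C\<in>G. width C \<le> 2 * (K * p ^ K * (2 ^ p) ^ (k + 1)))
     \<and> card G \<le> 2 ^ ((K * p + 3) * (2 * (K * p ^ K * (2 ^ p) ^ (k + 1))))
     \<and> (\<forall>\<pi>. resolution_refutation G \<pi> \<and> tree_like \<pi> \<longrightarrow> 2 ^ (2 ^ p) ^ (2 * k) \<le> refutation_size \<pi>)"
    (is "\<forall>p\<ge>1. \<exists>G. ?P p G") ..
  then have "\<forall>p. \<exists>G. 1 \<le> p \<longrightarrow> ?P p G"
    by blast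
  from choice[OF this] obtain H :: "nat \<Rightarrow> nat cnf" where "\<forall>p. 1 \<le> p \<longrightarrow> ?P p (H p)" ..
  then have H:
    "\<And>p. 1 \<le> p \<Longrightarrow> hitting_formula (H p)" "\<And>p. 1 \<le> p \<Longrightarrow> unsatisfiable (H p)"
    "\<And>p C. 1 \<le> p \<Longrightarrow> C \<in> H p \<Longrightarrow> width C \<le> 2 * (K * p ^ K * (2 ^ p) ^ (k + 1))"
    "\<And>p. 1 \<le> p \<Longrightarrow> card (H p) \<le> 2 ^ ((K * p + 3) * (2 * (K * p ^ K * (2 ^ p) ^ (k + 1))))"
    "\<And>p \<pi>. 1 \<le> p \<Longrightarrow> resolution_refutation (H p) \<pi> \<Longrightarrow> tree_like \<pi> \<Longrightarrow>
       2 ^ (2 ^ p) ^ (2 * k) \<le> refutation_size \<pi>"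
    by blast+
  \<comment> \<open>For large \<open>m\<close> this is the largest \<open>p\<close> with
    \<open>(2 ^ p) ^ (k + 1) \<le> m\<close>; the maximum with 1 provides a formula for small
    \<open>m\<close> too.\<close>
  define p where "p m = max 1 (nat \<lfloor>log 2 (real m) / real (k + 1)\<rfloor>)" for m
  define n where "n m = (2::nat) ^ p m" for m
  define w where "w m = 2 * (K * p m ^ K * n m ^ (k + 1))" for m
  define G where "G m = H (p m)" for m
  have p1: "1 \<le> p m" for m
    by (simp add: p_def)
  have m_pos: "0 < m" if "2 ^ (k + 1) \<le> m" for m :: nat
    using that by (metis gr0I not_one_le_zero one_le_numeral one_le_power le_trans)
  have p_bounds: "real (p m) * real (k + 1) \<le> log 2 (real m)"
    "log 2 (real m) \<le> (real (p m) + 1) * real (k + 1)" if m: "2 ^ (k + 1) \<le> m" for m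
  proof -
    have "real (2 ^ (k + 1)) \<le> real m"
      using m by (rule of_nat_mono)
    then have "log 2 (real (2 ^ (k + 1))) \<le> log 2 (real m)"
      using m_pos[OF m] by (subst log_le_cancel_iff) auto
    moreover have "log 2 (real (2 ^ (k + 1))) = real (k + 1)"
      by (subst of_nat_power, subst log_nat_power) simp_all
    ultimately have "real (k + 1) \<le> log 2 (real m)"
      by simp
    then have "1 \<le> log 2 (real m) / real (k + 1)"
      by (simp add: field_simps)
    then have "1 \<le> \<lfloor>log 2 (real m) / real (k + 1)\<rfloor>"
      by simp
    then have "real (p m) = of_int \<lfloor>log 2 (real m) / real (k + 1)\<rfloor>"
      unfolding p_def by linarith
    then have "real (p m) \<le> log 2 (real m) / real (k + 1)" "log 2 (real m) / real (k + 1) \<le> real (p m) + 1"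
      by linarith+
    then show "real (p m) * real (k + 1) \<le> log 2 (real m)"
      "log 2 (real m) \<le> (real (p m) + 1) * real (k + 1)"
      by (simp_all add: field_simps)
  qed
  have n_le: "real (n m) ^ (k + 1) \<le> real m" if m: "2 ^ (k + 1) \<le> m" for m
  proof -
    have "real (n m) ^ (k + 1) = (2 ^ p m) ^ (k + 1)"
      by (simp add: n_def)
    also have "\<dots> = 2 powr real (p m * (k + 1))"
      unfolding power_mult[symmetric] by (rule powr_realpow[symmetric]) simp
    also have "\<dots> = 2 powr (real (p m) * real (k + 1))"
      by (simp only: of_nat_mult)
    also have "\<dots> \<le> 2 powr log 2 (real m)"
      using p_bounds(1)[OF m] by simp
    finally show ?thesis
      using m_pos[OF m] by simp
  qed
  have p_le: "real (p m) \<le> ln (real m) / ln 2" if m: "2 ^ (k + 1) \<le> m" for m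
  proof -
    have "real (p m) * 1 \<le> real (p m) * real (k + 1)"
      by (intro mult_left_mono) auto
    then show ?thesis
      using p_bounds(1)[OF m] by (simp add: log_def)
  qed
  have w_le: "real (w m) \<le> 2 * K / ln 2 ^ K * (real m * ln (real m) ^ K)" if m: "2 ^ (k + 1) \<le> m" for m
  proof -
    have "real (w m) = 2 * K * real (p m) ^ K * real (n m) ^ (k + 1)"
      by (simp add: w_def)
    also have "\<dots> \<le> 2 * K * (ln (real m) / ln 2) ^ K * real m"
      using n_le[OF m] p_le[OF m] by (intro mult_mono power_mono) auto
    finally show ?thesis
      by (simp add: power_divide mult_ac)
  qed
  have w_O: "w \<in> soft_O real"
  proof (rule soft_O_realI)
    show "\<bar>real (w m)\<bar> \<le> 2 * K / ln 2 ^ K * (real m * ln (real m) ^ K)" if "2 ^ (k + 1) \<le> m" for m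
      unfolding abs_of_nat by (rule w_le[OF that])
  qed
  \<comment> \<open>An empty formula would be satisfiable; nonemptiness makes
    \<open>2 powr a m\<close> equal to the number of clauses.\<close>
  have G_ne: "card (G m) \<noteq> 0" for m
  proof -
    have "finite (G m)"
      using H(1)[OF p1[of m]] by (simp add: G_def hitting_formula_def is_cnf_def)
    moreover have "G m \<noteq> {}"
      using H(2)[OF p1[of m]] by (auto simp: G_def unsatisfiable_def)
    ultimately show ?thesis
      by simp
  qed
  define a where "a m = log 2 (real (card (G m)))" for m
  \<comment> \<open>The additional logarithm comes from the factor
    \<open>K * p m + 3\<close>.\<close>
  have a_le: "\<bar>a m\<bar> \<le> (K + 3) / ln 2 * (2 * K / ln 2 ^ K) * (real m * ln (real m) ^ Suc K)"
    if m: "2 ^ (k + 1) \<le> m" for m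
  proof -
    have "real (card (G m)) \<le> 2 ^ ((K * p m + 3) * w m)"
      using H(4)[OF p1[of m]] unfolding G_def w_def n_def
      by (metis of_nat_le_iff of_nat_numeral of_nat_power)
    then have "a m \<le> log 2 (2 ^ ((K * p m + 3) * w m))"
      unfolding a_def using G_ne[of m] by (subst log_le_cancel_iff) auto
    also have "\<dots> = real ((K * p m + 3) * w m)"
      by (simp add: log_nat_power)
    also have "\<dots> \<le> real ((K + 3) * p m * w m)"
    proof -
      have "K * p m + 3 \<le> (K + 3) * p m"
        using p1[of m] by (simp add: add_mult_distrib)
      then show ?thesis
        by (intro of_nat_mono mult_le_mono1)
    qed
    also have "\<dots> = (K + 3) * real (p m) * real (w m)"
      by simp
    also have "\<dots> \<le> (K + 3) * (ln (real m) / ln 2) * (2 * K / ln 2 ^ K * (real m * ln (real m) ^ K))"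
      using p_le[OF m] w_le[OF m] m_pos[OF m] by (intro mult_mono) auto
    finally have "a m \<le> (K + 3) / ln 2 * (2 * K / ln 2 ^ K) * (real m * ln (real m) ^ Suc K)"
      by (simp add: field_simps)
    moreover have "0 \<le> a m"
      unfolding a_def using G_ne[of m] by (simp add: Suc_le_eq)
    ultimately show ?thesis
      by simp
  qed
  have a_O: "a \<in> soft_O real"
    by (rule soft_O_realI[OF a_le])
  define s where "s m = real (n m) ^ (2 * k)" for m
  \<comment> \<open>Rounding in \<open>p\<close> gives m \<le> (2n)^(k+1), so only the constant
    factor \<open>2 ^ (2 * k)\<close> is lost.\<close>
  have s_ge: "real m powr (2 - \<epsilon>) \<le> 2 ^ (2 * k) * s m" if m: "2 ^ (k + 1) \<le> m" for m
  proof -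
    have "2 \<le> real (k + 1) * \<epsilon>"
      using k assms by (simp add: field_simps)
    then have e: "2 - \<epsilon> \<le> 2 * real k / real (k + 1)"
      by (simp add: field_simps)
    have "real m powr (2 - \<epsilon>) \<le> real m powr (2 * real k / real (k + 1))"
      using m_pos[OF m] e by (intro powr_mono) auto
    also have "\<dots> = 2 powr (log 2 (real m) * (2 * real k / real (k + 1)))"
      unfolding powr_powr[symmetric] using m_pos[OF m] by simp
    also have "\<dots> \<le> 2 powr ((real (p m) + 1) * real (k + 1) * (2 * real k / real (k + 1)))"
      using p_bounds(2)[OF m] by (intro powr_mono mult_right_mono) auto
    also have "(real (p m) + 1) * real (k + 1) * (2 * real k / real (k + 1)) = real (2 * k + p m * (2 * k))"
    proof -
      have "real (k + 1) * (2 * real k / real (k + 1)) = 2 * real k"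
        by simp
      then show ?thesis
        by (simp only: mult.assoc) (simp add: algebra_simps)
    qed
    also have "2 powr real (2 * k + p m * (2 * k)) = 2 ^ (2 * k) * s m"
      unfolding s_def n_def by (subst powr_realpow) (simp_all add: power_add power_mult)
    finally show ?thesis .
  qed
  have "s \<in> \<Omega>(\<lambda>m. real m powr (2 - \<epsilon>) / ln (real m powr (2 - \<epsilon>)) ^ 0)"
  proof (rule landau_omega.bigI)
    show "eventually (\<lambda>m. norm (s m) \<ge> 1 / 2 ^ (2 * k)
        * norm (real m powr (2 - \<epsilon>) / ln (real m powr (2 - \<epsilon>)) ^ 0)) at_top"
    proof (rule eventually_mono[OF eventually_ge_at_top[of "2 ^ (k + 1)"]])
      fix m :: nat assume "2 ^ (k + 1) \<le> m"
      from s_ge[OF this] show "1 / 2 ^ (2 * k)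
          * norm (real m powr (2 - \<epsilon>) / ln (real m powr (2 - \<epsilon>)) ^ 0) \<le> norm (s m)"
        by (simp add: field_simps s_def)
    qed
  qed simp
  then have s_Omega: "s \<in> soft_Omega (\<lambda>m. real m powr (2 - \<epsilon>))"
    unfolding soft_Omega_def by (intro CollectI conjI exI[of _ 0]) (auto simp: s_def)
  have "\<forall>m. hitting_formula (G m) \<and> unsatisfiable (G m)"
    using H(1,2)[OF p1] by (simp add: G_def)
  moreover have "\<exists>a \<in> soft_O (\<lambda>m. real m). \<forall>m. real (card (G m)) = 2 powr a m"
    using a_O G_ne by (intro bexI[of _ a]) (simp_all add: a_def)
  moreover have "\<exists>w \<in> soft_O (\<lambda>m. real m). \<forall>m. \<forall>C \<in> G m. real (width C) \<le> w m"
  proof (intro bexI[OF _ w_O] allI ballI)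
    show "real (width C) \<le> real (w m)" if "C \<in> G m" for m C
      using H(3)[OF p1 that[unfolded G_def]] unfolding w_def n_def of_nat_le_iff .
  qed
  moreover have "\<exists>s \<in> soft_Omega (\<lambda>m. real m powr (2 - \<epsilon>)).
       \<forall>m \<pi>. resolution_refutation (G m) \<pi> \<and> tree_like \<pi> \<longrightarrow>
              real (refutation_size \<pi>) \<ge> 2 powr s m"
  proof (intro bexI[OF _ s_Omega] allI impI)
    fix m \<pi> assume "resolution_refutation (G m) \<pi> \<and> tree_like \<pi>"
    then have "2 ^ (n m ^ (2 * k)) \<le> refutation_size \<pi>"
      using H(5)[OF p1] unfolding G_def n_def by blast
    then have "real (2 ^ (n m ^ (2 * k))) \<le> real (refutation_size \<pi>)"
      by (rule of_nat_mono)
    moreover have "2 powr s m = real (2 ^ (n m ^ (2 * k)))"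
      unfolding s_def of_nat_power[symmetric] by (subst powr_realpow) simp_all
    ultimately show "2 powr s m \<le> real (refutation_size \<pi>)"
      by simp
  qed
  ultimately show ?thesis
    by blast
qed

end
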